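(* Let $G$ be a finite group. If $|G| = n_k(G)^2$ for some positive integer $k$, then $k \equiv 2 \pmod 4$ and $G \cong C_4$.
   Context: For a finite group $G$ and an integer $k>0$, write $G^{k}=\{x^{k} : x\in G\}$ (the set of $k$-th powers), $\mathcal{N}_k(G)=G\setminus G^{k}$ (the set of non-$k$-th powers), and $n_k(G)=|\mathcal{N}_k(G)|$. $C_4$ denotes the cyclic group of order $4$. *)

theory Defs
  imports "HOL-Algebra.Algebra" "HOL-Number_Theory.Cong"
begin

text \<open>
  The set \<open>G\<^sup>k\<close> consists of the \<open>k\<close>-th powers of elements of \<open>G\<close>; it is in general not a
  subgroup, and it is not the subgroup generated by these powers.
\<close>

definition kth_powers :: "('a, 'b) monoid_scheme \<Rightarrow> nat \<Rightarrow> 'a set"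
  where "kth_powers G k = {x [^]\<^bsub>G\<^esub> k | x. x \<in> carrier G}"

definition non_kth_powers :: "('a, 'b) monoid_scheme \<Rightarrow> nat \<Rightarrow> 'a set"
  where "non_kth_powers G k = carrier G - kth_powers G k"

definition num_non_kth_powers :: "('a, 'b) monoid_scheme \<Rightarrow> nat \<Rightarrow> nat"
  where "num_non_kth_powers G k = card (non_kth_powers G k)"

end

(*
  Let |G| = n^2, let p be a prime dividing both k and |G| = p^s r, and let T be the set of elements
  whose order is divisible by the largest power of p that divides any element order. No element of T
  is a k-th power, so |T| <= n. For x in T with centralizer C, multiplication by powers of x shows
  that at least (1 - 1/p) |C| elements of C lie in T, while the class of x has n^2 / |C| elements.
  Hence either |C| = 2n, which forces G to be a 2-group, or T is a single class and C is a p-group.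
  In the second case T is not contained in C, since otherwise C is abelian and q (q - 1) would be a
  square for some q > 1. Comparing C with the centralizer of an element of T outside C leaves p = 2
  unless G is a p-group; a coset of C then gives too many elements of T unless x has order 4. Then
  the k-th powers are the elements of odd order, whose number is divisible by |G|_{2'} (Frobenius),
  and possibly the squares of the elements of T; with n^2 = n + |G^k| this again forces G to be a
  2-group. Finally, in a p-group the k-th power map is constant on the cosets of a central subgroup
  of order p, so n >= |G| / 2 and n = 2.
*)
theory Submission
  imports Defs
begin

hide_const (open) Divisibility.prime

section \<open>Conjugacy classes and centralizers\<close>

definition conj_by :: "('a, 'b) monoid_scheme \<Rightarrow> 'a \<Rightarrow> 'a \<Rightarrow> 'a"
  where "conj_by G g x = g \<otimes>\<^bsub>G\<^esub> x \<otimes>\<^bsub>G\<^esub> inv\<^bsub>G\<^esub> g"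

definition conj_class :: "('a, 'b) monoid_scheme \<Rightarrow> 'a \<Rightarrow> 'a set"
  where "conj_class G x = (\<lambda>g. conj_by G g x) ` carrier G"

definition cent :: "('a, 'b) monoid_scheme \<Rightarrow> 'a \<Rightarrow> 'a set"
  where "cent G x = {g \<in> carrier G. g \<otimes>\<^bsub>G\<^esub> x = x \<otimes>\<^bsub>G\<^esub> g}"

context group
begin

lemma conj_by_closed [simp]:
  "g \<in> carrier G \<Longrightarrow> x \<in> carrier G \<Longrightarrow> conj_by G g x \<in> carrier G"
  by (simp add: conj_by_def)

lemma conj_by_one [simp]: "x \<in> carrier G \<Longrightarrow> conj_by G \<one> x = x"
  by (simp add: conj_by_def)

lemma conj_by_id [simp]: "g \<in> carrier G \<Longrightarrow> conj_by G g \<one> = \<one>"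
  by (simp add: conj_by_def)

lemma conj_by_conj_by:
  "\<lbrakk>g \<in> carrier G; h \<in> carrier G; x \<in> carrier G\<rbrakk>
    \<Longrightarrow> conj_by G h (conj_by G g x) = conj_by G (h \<otimes> g) x"
  by (simp add: conj_by_def inv_mult_group m_assoc)

lemma conj_by_mult:
  assumes "g \<in> carrier G" "x \<in> carrier G" "y \<in> carrier G"
  shows "conj_by G g (x \<otimes> y) = conj_by G g x \<otimes> conj_by G g y"
proof -
  have "inv g \<otimes> (g \<otimes> (y \<otimes> inv g)) = y \<otimes> inv g"
    using assms by (simp add: m_assoc [symmetric])
  then show ?thesis
    using assms by (simp add: conj_by_def m_assoc)
qed

lemma conj_by_pow:
  "g \<in> carrier G \<Longrightarrow> x \<in> carrier G \<Longrightarrow> conj_by G g (x [^] (n::nat)) = conj_by G g x [^] n"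
  by (induction n) (simp_all add: conj_by_mult)

lemma conj_by_inv_conj_by [simp]:
  "g \<in> carrier G \<Longrightarrow> x \<in> carrier G \<Longrightarrow> conj_by G (inv g) (conj_by G g x) = x"
  by (simp add: conj_by_conj_by)

lemma conj_by_conj_by_inv [simp]:
  "g \<in> carrier G \<Longrightarrow> x \<in> carrier G \<Longrightarrow> conj_by G g (conj_by G (inv g) x) = x"
  by (simp add: conj_by_conj_by)

lemma conj_by_inj: "g \<in> carrier G \<Longrightarrow> inj_on (conj_by G g) (carrier G)"
  by (rule inj_on_inverseI [where g = "conj_by G (inv g)"]) simp

lemma conj_by_eq_one_iff [simp]:
  assumes "g \<in> carrier G" "x \<in> carrier G"
  shows "conj_by G g x = \<one> \<longleftrightarrow> x = \<one>"
  using inj_on_eq_iff [OF conj_by_inj [OF assms(1)] assms(2) one_closed] assms(1) by simp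

lemma conj_by_pow_eq_one_iff [simp]:
  assumes "g \<in> carrier G" "x \<in> carrier G"
  shows "conj_by G g x [^] (n::nat) = \<one> \<longleftrightarrow> x [^] n = \<one>"
  using assms by (simp add: conj_by_pow [symmetric])

lemma conj_by_eq_self_iff:
  assumes "g \<in> carrier G" "x \<in> carrier G"
  shows "conj_by G g x = x \<longleftrightarrow> g \<in> cent G x"
  using assms by (simp add: conj_by_def cent_def inv_solve_right')

lemma cent_closed: "g \<in> cent G x \<Longrightarrow> g \<in> carrier G"
  by (simp add: cent_def)

lemma cent_subset: "cent G x \<subseteq> carrier G"
  by (auto simp: cent_def)

lemma cent_comm: "g \<in> cent G x \<Longrightarrow> g \<otimes> x = x \<otimes> g"
  by (simp add: cent_def)

lemma cent_sym: "g \<in> cent G x \<Longrightarrow> x \<in> carrier G \<Longrightarrow> x \<in> cent G g"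
  by (simp add: cent_def)

lemma self_cent [simp]: "x \<in> carrier G \<Longrightarrow> x \<in> cent G x"
  by (simp add: cent_def)

lemma subgroup_cent:
  assumes "x \<in> carrier G"
  shows "subgroup (cent G x) G"
proof (rule subgroupI)
  fix a assume "a \<in> cent G x"
  then have a: "a \<in> carrier G" "conj_by G a x = x"
    using assms by (auto simp: conj_by_eq_self_iff cent_closed)
  then have "conj_by G (inv a) x = x"
    using assms by (metis conj_by_inv_conj_by)
  then show "inv a \<in> cent G x"
    using a assms by (simp add: conj_by_eq_self_iff)
next
  fix a b assume "a \<in> cent G x" "b \<in> cent G x"
  then show "a \<otimes> b \<in> cent G x"
    using assms by (metis conj_by_conj_by conj_by_eq_self_iff cent_closed m_closed)
qed (use assms in \<open>auto simp: cent_def\<close>)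

lemma cent_mult: "\<lbrakk>x \<in> carrier G; a \<in> cent G x; b \<in> cent G x\<rbrakk> \<Longrightarrow> a \<otimes> b \<in> cent G x"
  by (rule subgroup.m_closed [OF subgroup_cent])

lemma cent_inv: "\<lbrakk>x \<in> carrier G; a \<in> cent G x\<rbrakk> \<Longrightarrow> inv a \<in> cent G x"
  by (rule subgroup.m_inv_closed [OF subgroup_cent])

lemma cent_one: "x \<in> carrier G \<Longrightarrow> \<one> \<in> cent G x"
  by (simp add: cent_def)

lemma cent_pow: "\<lbrakk>x \<in> carrier G; a \<in> cent G x\<rbrakk> \<Longrightarrow> a [^] (n::nat) \<in> cent G x"
  by (induction n) (simp_all add: cent_one cent_mult)

lemma cent_subset_cent_pow: "x \<in> carrier G \<Longrightarrow> cent G x \<subseteq> cent G (x [^] (n::nat))"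
  by (metis cent_closed cent_pow cent_sym nat_pow_closed subsetI)

lemma cent_conj_by:
  assumes g: "g \<in> carrier G" and x: "x \<in> carrier G"
  shows "cent G (conj_by G g x) = conj_by G g ` cent G x"
proof -
  have imp: "conj_by G h y \<in> cent G (conj_by G h z)"
    if "h \<in> carrier G" "z \<in> carrier G" "y \<in> cent G z" for h y z
    using that unfolding cent_def by (auto simp: conj_by_mult [symmetric])
  show ?thesis
  proof
    show "cent G (conj_by G g x) \<subseteq> conj_by G g ` cent G x"
    proof
      fix y assume y: "y \<in> cent G (conj_by G g x)"
      have "conj_by G (inv g) y \<in> cent G x"
        using imp [OF _ _ y, of "inv g"] g x by simp
      moreover have "y = conj_by G g (conj_by G (inv g) y)"
        using y g by (simp add: cent_closed)
      ultimately show "y \<in> conj_by G g ` cent G x" by blast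
    qed
  qed (use imp g x in auto)
qed

lemma card_cent_conj_by:
  assumes "g \<in> carrier G" "x \<in> carrier G"
  shows "card (cent G (conj_by G g x)) = card (cent G x)"
  unfolding cent_conj_by [OF assms]
  by (rule card_image) (rule inj_on_subset [OF conj_by_inj [OF assms(1)] cent_subset])

lemma conj_class_subset: "x \<in> carrier G \<Longrightarrow> conj_class G x \<subseteq> carrier G"
  by (auto simp: conj_class_def)

lemma self_conj_class [simp]: "x \<in> carrier G \<Longrightarrow> x \<in> conj_class G x"
  unfolding conj_class_def by (rule image_eqI [where x = \<one>]) simp_all

lemma conj_class_conj_by:
  assumes "x \<in> carrier G" "g \<in> carrier G"
  shows "conj_class G (conj_by G g x) = conj_class G x"
proof -
  have sub: "conj_class G (conj_by G h y) \<subseteq> conj_class G y"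
    if "y \<in> carrier G" "h \<in> carrier G" for y h
    using that unfolding conj_class_def by (auto simp: conj_by_conj_by)
  show ?thesis
    using sub [OF assms] sub [of "conj_by G g x" "inv g"] assms by auto
qed

lemma conj_class_eq:
  "\<lbrakk>x \<in> carrier G; y \<in> conj_class G x\<rbrakk> \<Longrightarrow> conj_class G y = conj_class G x"
  by (auto simp: conj_class_def [of G x] conj_class_conj_by)

lemma conj_class_disjoint:
  "\<lbrakk>x \<in> carrier G; y \<in> carrier G; y \<notin> conj_class G x\<rbrakk> \<Longrightarrow> conj_class G x \<inter> conj_class G y = {}"
  by (metis conj_class_eq disjoint_iff self_conj_class)

lemma card_le_if_conj_by:
  assumes "finite A" "finite B" "g \<in> carrier G" "A \<subseteq> carrier G"
    "\<And>a. a \<in> A \<Longrightarrow> conj_by G g a \<in> B"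
  shows "card A \<le> card B"
  using assms by (meson card_inj_on_le conj_by_inj image_subsetI inj_on_subset)

end

locale finite_group = group +
  assumes finite_carrier [simp]: "finite (carrier G)"
begin

lemma finite_cent [simp]: "finite (cent G x)"
  by (rule finite_subset [OF cent_subset finite_carrier])

lemma finite_conj_class [simp]: "finite (conj_class G x)"
  unfolding conj_class_def by simp

lemma order_pos [simp]: "order G > 0"
  by (simp add: order_gt_0_iff_finite)

lemma card_conj_class:
  assumes x: "x \<in> carrier G"
  shows "card (conj_class G x) * card (cent G x) = order G"
proof -
  let ?F = "\<lambda>y. {g \<in> carrier G. conj_by G g x = y}"
  have fib: "card (?F y) = card (cent G x)" if y: "y \<in> conj_class G x" for y
  proof -
    obtain g where g: "g \<in> carrier G" "y = conj_by G g x"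
      using y by (auto simp: conj_class_def)
    have "bij_betw (\<lambda>h. g \<otimes> h) (cent G x) (?F y)"
    proof (rule bij_betw_byWitness [where f' = "\<lambda>h. inv g \<otimes> h"])
      show "(\<lambda>h. g \<otimes> h) ` cent G x \<subseteq> ?F y"
      proof clarify
        fix h assume h: "h \<in> cent G x"
        then have "conj_by G h x = x"
          using x by (simp add: conj_by_eq_self_iff cent_closed)
        then show "g \<otimes> h \<in> carrier G \<and> conj_by G (g \<otimes> h) x = y"
          using g x h by (simp add: conj_by_conj_by [symmetric] cent_closed)
      qed
      show "(\<lambda>h. inv g \<otimes> h) ` ?F y \<subseteq> cent G x"
      proof clarify
        fix h assume h: "h \<in> carrier G" "y = conj_by G h x"
        have "conj_by G (inv g \<otimes> h) x = conj_by G (inv g) y"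
          using h g x by (simp add: conj_by_conj_by)
        also have "\<dots> = x"
          using g x by simp
        finally show "inv g \<otimes> h \<in> cent G x"
          using h g x by (simp add: conj_by_eq_self_iff)
      qed
    qed (use g x in \<open>auto simp: m_assoc [symmetric] cent_closed\<close>)
    then show ?thesis by (simp add: bij_betw_same_card)
  qed
  have "order G = card (\<Union>y\<in>conj_class G x. ?F y)"
    unfolding order_def by (rule arg_cong [where f = card]) (auto simp: conj_class_def)
  also have "\<dots> = (\<Sum>y\<in>conj_class G x. card (?F y))"
    by (rule card_UN_disjoint) auto
  also have "\<dots> = card (conj_class G x) * card (cent G x)"
    by (simp add: fib)
  finally show ?thesis ..
qed

lemma card_subgroup_dvd: "subgroup H G \<Longrightarrow> card H dvd order G"
  using lagrange dvd_triv_right by metis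

lemma finite_group_subgroup:
  assumes "subgroup H G"
  shows "finite_group (G\<lparr>carrier := H\<rparr>)"
  unfolding finite_group_def finite_group_axioms_def
  using subgroup.subgroup_is_group [OF assms is_group]
    finite_subset [OF subgroup.subset [OF assms] finite_carrier] by simp

lemma Cauchy:
  assumes "prime q" "q dvd order G"
  obtains u where "u \<in> carrier G" "u \<noteq> \<one>" "u [^] q = \<one>"
proof -
  obtain m where m: "order G = q ^ 1 * m" using assms by auto
  obtain H where H: "subgroup H G" "card H = q"
    using sylow_thm [OF assms(1) is_group m finite_carrier] by auto
  have "card H > 1" using H assms(1) prime_gt_1_nat by auto
  then obtain u where u: "u \<in> H" "u \<noteq> \<one>"
    by (metis One_nat_def card_1_singleton_iff card_gt_0_iff is_singletonI' is_singleton_altdef less_one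
        nat_neq_iff not_less_zero zero_less_one)
  interpret H: group "G\<lparr>carrier := H\<rparr>"
    by (rule subgroup.subgroup_is_group [OF H(1) is_group])
  have "u [^]\<^bsub>G\<lparr>carrier := H\<rparr>\<^esub> order (G\<lparr>carrier := H\<rparr>) = \<one>"
    using H.pow_order_eq_1 [of u] u by simp
  then have "u [^] q = \<one>"
    using H nat_pow_consistent by (simp add: order_def)
  then show thesis using that u H subgroup.mem_carrier by metis
qed

lemma Cauchy_subgroup:
  assumes H: "subgroup H G" and "prime q" "q dvd card H"
  obtains u where "u \<in> H" "u \<noteq> \<one>" "u [^] q = \<one>"
proof -
  interpret H: finite_group "G\<lparr>carrier := H\<rparr>"
    by (rule finite_group_subgroup [OF H])
  obtain u where "u \<in> H" "u \<noteq> \<one>" "u [^]\<^bsub>G\<lparr>carrier := H\<rparr>\<^esub> q = \<one>"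
    using H.Cauchy [of q] assms by (auto simp: order_def)
  then show thesis using that nat_pow_consistent by metis
qed

lemma pow_gcd_eq_one:
  assumes "u \<in> carrier G" "u [^] (i::nat) = \<one>" "u [^] (j::nat) = \<one>" "coprime i j"
  shows "u = \<one>"
proof -
  have "ord u dvd i" "ord u dvd j"
    using assms pow_eq_id by blast+
  then have "ord u = 1"
    using assms(4) by (meson coprime_common_divisor_nat nat_dvd_1_iff_1)
  then show ?thesis using ord_eq_1 assms(1) by blast
qed

lemma sum_noncentral_dvd:
  fixes f :: "'a \<Rightarrow> nat"
  assumes S: "S \<subseteq> carrier G"
    and Sc: "\<And>g s. g \<in> carrier G \<Longrightarrow> s \<in> S \<Longrightarrow> conj_by G g s \<in> S"
    and fc: "\<And>g s. g \<in> carrier G \<Longrightarrow> s \<in> S \<Longrightarrow> f (conj_by G g s) = f s"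
    and d: "\<And>s. s \<in> S \<Longrightarrow> cent G s \<noteq> carrier G \<Longrightarrow> d dvd card (conj_class G s) * f s"
  shows "d dvd (\<Sum>s \<in> {s \<in> S. cent G s \<noteq> carrier G}. f s)"
proof -
  let ?N = "{s \<in> S. cent G s \<noteq> carrier G}"
  have Nc: "conj_by G g s \<in> ?N" if "g \<in> carrier G" "s \<in> ?N" for g s
  proof -
    have s: "s \<in> carrier G" "cent G s \<noteq> carrier G" using that S by auto
    have "cent G (conj_by G g s) \<noteq> carrier G"
      using card_cent_conj_by [OF that(1) s(1)] s(2) cent_subset
      by (metis card_subset_eq finite_carrier)
    then show ?thesis using that Sc by auto
  qed
  have "?N = \<Union> (conj_class G ` ?N)"
  proof
    show "?N \<subseteq> \<Union> (conj_class G ` ?N)"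
      using S self_conj_class by fastforce
    show "\<Union> (conj_class G ` ?N) \<subseteq> ?N"
      using Nc unfolding conj_class_def by blast
  qed
  then have "sum f ?N = sum f (\<Union> (conj_class G ` ?N))" by simp
  also have "\<dots> = (\<Sum>A\<in>conj_class G ` ?N. sum f A)"
  proof (subst sum.Union_disjoint)
    show "\<forall>A\<in>conj_class G ` ?N. \<forall>B\<in>conj_class G ` ?N. A \<noteq> B \<longrightarrow> A \<inter> B = {}"
    proof clarify
      fix u v assume uv: "u \<in> S" "v \<in> S" "conj_class G u \<noteq> conj_class G v"
      then have "v \<notin> conj_class G u"
        using S conj_class_eq by blast
      then show "conj_class G u \<inter> conj_class G v = {}"
        using uv S by (intro conj_class_disjoint) auto
    qed
  qed auto
  also have "d dvd \<dots>"
  proof (rule dvd_sum)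
    fix A assume "A \<in> conj_class G ` ?N"
    then obtain s where s: "s \<in> S" "cent G s \<noteq> carrier G" "A = conj_class G s" by auto
    have "sum f A = (\<Sum>a\<in>A. f s)"
      using s fc by (intro sum.cong) (auto simp: conj_class_def)
    then show "d dvd sum f A" using d s by simp
  qed
  finally show ?thesis .
qed

end

section \<open>The number of p'-elements\<close>

lemma prime_power_of_prime_divisors:
  fixes n :: nat
  assumes "prime p" "n > 0" "\<And>q. prime q \<Longrightarrow> q dvd n \<Longrightarrow> q = p"
  obtains i where "n = p ^ i"
proof -
  have "n \<noteq> 0" "\<not> is_unit p"
    using assms(1,2) prime_gt_1_nat by fastforce+
  then obtain m where m: "\<not> p dvd m" "n = p ^ multiplicity p n * m"
    using multiplicity_decompose' by metis
  have "m = 1"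
    using m assms(3) by (metis dvd_triv_right dvd_trans prime_factor_nat)
  then show thesis using m that by simp
qed

context finite_group
begin

lemma pow_cong:
  assumes "h \<in> carrier G" "h [^] (n::nat) = \<one>" "[i = j] (mod n)"
  shows "h [^] i = h [^] j"
proof -
  have red: "h [^] k = h [^] (k mod n)" for k :: nat
  proof -
    have "h [^] k = h [^] (n * (k div n) + k mod n)" by simp
    also have "\<dots> = (h [^] n) [^] (k div n) \<otimes> h [^] (k mod n)"
      using assms(1) by (simp add: nat_pow_mult nat_pow_pow)
    finally show ?thesis using assms by simp
  qed
  show ?thesis using red [of i] red [of j] assms(3) by (simp add: cong_def)
qed

lemma pow_dvd_eq_one:
  assumes "h \<in> carrier G" "h [^] (n::nat) = \<one>" "n dvd m"
  shows "h [^] m = \<one>"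
  using assms by (metis dvdE nat_pow_one nat_pow_pow)

lemma coprime_pow_root:
  assumes "y \<in> carrier G" "y [^] (r::nat) = \<one>" "coprime k r"
  obtains v where "v \<in> carrier G" "v [^] k = y"
proof -
  obtain l where l: "[k * l = 1] (mod r)"
    using cong_solve_coprime_nat assms(3) by (metis One_nat_def)
  have "(y [^] l) [^] k = y [^] (1::nat)"
    using assms l by (simp only: nat_pow_pow mult.commute [of l k]) (rule pow_cong)
  then show thesis using that [of "y [^] l"] assms by simp
qed

lemma order_eq_sum_cent:
  assumes ord: "order G dvd P * r" and cop: "coprime P r"
  shows "order G = (\<Sum>s | s \<in> carrier G \<and> s [^] P = \<one>. card {y \<in> cent G s. y [^] r = \<one>})"
proof -
  let ?S = "{s \<in> carrier G. s [^] P = \<one>}"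
  let ?Y = "\<lambda>s. {y \<in> cent G s. y [^] r = \<one>}"
  obtain i where i: "[i = 1] (mod P)" "[i = 0] (mod r)"
    using binary_chinese_remainder_nat [OF cop] by blast
  obtain j where j: "[j = 0] (mod P)" "[j = 1] (mod r)"
    using binary_chinese_remainder_nat [OF cop] by blast
  have ij: "[i + j = 1] (mod P * r)"
    using cong_add [OF i(1) j(1)] cong_add [OF i(2) j(2)] cop
    by (auto intro!: coprime_cong_mult_nat)
  have dv: "r dvd i" "P dvd j"
    using i j by (auto simp: cong_0_iff)
  have pow1: "h [^] (P * r) = \<one>" if "h \<in> carrier G" for h
    using pow_dvd_eq_one [OF that pow_order_eq_1 [OF that] ord] .
  have "bij_betw (\<lambda>(s, y). s \<otimes> y) (Sigma ?S ?Y) (carrier G)"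
  proof (rule bij_betw_byWitness [where f' = "\<lambda>h. (h [^] i, h [^] j)"])
    show "\<forall>a\<in>Sigma ?S ?Y. ((case a of (s, y) \<Rightarrow> s \<otimes> y) [^] i, (case a of (s, y) \<Rightarrow> s \<otimes> y) [^] j) = a"
    proof clarify
      fix s y assume sy: "s \<in> carrier G" "s [^] P = \<one>" "y \<in> cent G s" "y [^] r = \<one>"
      then have c: "y \<in> carrier G" "s \<otimes> y = y \<otimes> s"
        by (auto simp: cent_def)
      have e: "s [^] i = s" "s [^] j = \<one>" "y [^] i = \<one>" "y [^] j = y"
        using pow_cong [OF sy(1,2) i(1)] pow_cong [OF sy(1,2) j(1)]
          pow_cong [OF c(1) sy(4) i(2)] pow_cong [OF c(1) sy(4) j(2)] sy c by auto
      show "(s \<otimes> y) [^] i = s \<and> (s \<otimes> y) [^] j = y"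
        using pow_mult_distrib [OF c(2) sy(1) c(1)] e sy c by simp
    qed
    show "\<forall>h\<in>carrier G. (case (h [^] i, h [^] j) of (s, y) \<Rightarrow> s \<otimes> y) = h"
    proof
      fix h assume h: "h \<in> carrier G"
      show "(case (h [^] i, h [^] j) of (s, y) \<Rightarrow> s \<otimes> y) = h"
        using pow_cong [OF h pow1 [OF h] ij] h by (simp add: nat_pow_mult)
    qed
    show "(\<lambda>h. (h [^] i, h [^] j)) ` carrier G \<subseteq> Sigma ?S ?Y"
    proof (rule image_subsetI)
      fix h assume h: "h \<in> carrier G"
      have "(h [^] i) [^] P = \<one>" "(h [^] j) [^] r = \<one>"
        using dv h by (auto simp: nat_pow_pow intro!: pow_dvd_eq_one [OF h pow1 [OF h]]
            simp: mult.commute [of P r] mult_dvd_mono)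
      moreover have "h [^] j \<in> cent G (h [^] i)"
        using h by (simp add: cent_pow cent_sym)
      ultimately show "(h [^] i, h [^] j) \<in> Sigma ?S ?Y"
        using h by simp
    qed
  qed (auto simp: cent_closed)
  then have "order G = card (Sigma ?S ?Y)"
    by (simp add: order_def bij_betw_same_card)
  then show ?thesis by (subst (asm) card_SigmaI) auto
qed

lemma subgroup_central_pow:
  "subgroup {s \<in> carrier G. s [^] (P::nat) = \<one> \<and> cent G s = carrier G} G"
  (is "subgroup ?Z G")
proof (rule subgroupI)
  have central: "cent G s = carrier G \<longleftrightarrow> (\<forall>g\<in>carrier G. s \<in> cent G g)" if "s \<in> carrier G" for s
    using that cent_subset cent_sym by blast
  show "?Z \<noteq> {}"
    by (auto simp: cent_def intro!: exI [of _ \<one>])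
  fix a assume a: "a \<in> ?Z"
  then show "inv a \<in> ?Z"
    using central [of a] central [of "inv a"] by (auto simp: nat_pow_inv cent_inv)
  fix b assume b: "b \<in> ?Z"
  have "a \<otimes> b = b \<otimes> a"
    using a b by (auto simp: cent_def)
  then show "a \<otimes> b \<in> ?Z"
    using a b central [of a] central [of b] central [of "a \<otimes> b"]
    by (auto simp: pow_mult_distrib cent_mult)
qed auto

lemma prime_power_of_pow:
  assumes H: "subgroup H G" and p: "prime p"
    and pw: "\<And>h. h \<in> H \<Longrightarrow> h [^] (p ^ s) = \<one>"
  obtains i where "card H = p ^ i"
proof (rule prime_power_of_prime_divisors [OF p])
  show "card H > 0"
    by (metis H card_gt_0_iff finite_carrier finite_subset subgroup.subset subgroup.one_closed empty_iff)
  fix q assume q: "prime q" "q dvd card H"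
  show "q = p"
  proof (rule ccontr)
    assume "q \<noteq> p"
    then have "coprime q (p ^ s)"
      using q p primes_coprime by auto
    moreover obtain u where u: "u \<in> H" "u \<noteq> \<one>" "u [^] q = \<one>"
      using Cauchy_subgroup [OF H q] .
    ultimately show False
      using pow_gcd_eq_one pw subgroup.mem_carrier [OF H] by blast
  qed
qed

lemma p_group_central_element:
  assumes p: "prime p" and ord: "order G = p ^ s" and s: "s > 0"
  obtains z where "z \<in> carrier G" "z \<noteq> \<one>" "z [^] p = \<one>" "cent G z = carrier G"
proof -
  let ?Z = "{s \<in> carrier G. cent G s = carrier G}"
  let ?N = "{s \<in> carrier G. cent G s \<noteq> carrier G}"
  have "p dvd (\<Sum>s\<in>?N. 1)"
  proof (rule sum_noncentral_dvd)
    fix t assume t: "t \<in> carrier G" "cent G t \<noteq> carrier G"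
    have mc: "card (conj_class G t) * card (cent G t) = p ^ s"
      using card_conj_class [OF t(1)] ord by simp
    then obtain i where i: "card (conj_class G t) = p ^ i"
      using p by (metis dvd_triv_left divides_primepow_nat)
    have "card (cent G t) \<noteq> p ^ s"
      using t(2) ord cent_subset [of t] by (metis card_subset_eq finite_carrier order_def)
    then have "i \<noteq> 0" using mc i by (cases i) auto
    then show "p dvd card (conj_class G t) * 1"
      using i by simp
  qed auto
  moreover have "order G = card ?Z + card ?N"
    unfolding order_def by (subst card_Un_disjoint [symmetric]) (auto intro!: arg_cong [where f = card])
  moreover have "p dvd order G"
    using ord s by simp
  ultimately have "p dvd card ?Z"
    by (simp add: dvd_add_left_iff)
  moreover have Zeq: "?Z = {s \<in> carrier G. s [^] order G = \<one> \<and> cent G s = carrier G}"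
    using pow_order_eq_1 by auto
  ultimately have "p dvd card {s \<in> carrier G. s [^] order G = \<one> \<and> cent G s = carrier G}"
    by simp
  from Cauchy_subgroup [OF subgroup_central_pow p this] that show thesis
    by blast
qed

lemma Frobenius_coprime_part_step:
  assumes p: "prime p" "coprime p r"
    and ord: "order G dvd p ^ s * r" and d: "d dvd r" "d dvd order G"
    and IH: "\<And>t. t \<in> carrier G \<Longrightarrow> cent G t \<noteq> carrier G \<Longrightarrow>
      gcd d (card (cent G t)) dvd card {y \<in> cent G t. y [^] r = \<one>}"
  shows "d dvd card {y \<in> carrier G. y [^] r = \<one>}"
proof -
  let ?S = "{t \<in> carrier G. t [^] (p ^ s) = \<one>}"
  let ?f = "\<lambda>t. card {y \<in> cent G t. y [^] r = \<one>}"
  let ?N = "{t \<in> ?S. cent G t \<noteq> carrier G}"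
  let ?Z = "{t \<in> carrier G. t [^] (p ^ s) = \<one> \<and> cent G t = carrier G}"
  have N: "d dvd sum ?f ?N"
  proof (rule sum_noncentral_dvd)
    fix g t assume gt: "g \<in> carrier G" "t \<in> ?S"
    then show "conj_by G g t \<in> ?S"
      by simp
    have pw: "conj_by G g y [^] r = \<one> \<longleftrightarrow> y [^] r = \<one>" if "y \<in> carrier G" for y
      using that gt by simp
    have "{y \<in> cent G (conj_by G g t). y [^] r = \<one>} = conj_by G g ` {y \<in> cent G t. y [^] r = \<one>}"
      using gt pw cent_closed by (auto simp: cent_conj_by)
    moreover have "inj_on (conj_by G g) {y \<in> cent G t. y [^] r = \<one>}"
      using gt cent_closed by (intro inj_on_subset [OF conj_by_inj]) auto
    ultimately show "?f (conj_by G g t) = ?f t"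
      by (simp add: card_image)
  next
    fix t assume t: "t \<in> ?S" "cent G t \<noteq> carrier G"
    have mc: "card (conj_class G t) * card (cent G t) = order G"
      using t card_conj_class by auto
    have "d dvd gcd (card (conj_class G t) * d) (card (conj_class G t) * card (cent G t))"
      using d mc by simp
    also have "\<dots> = card (conj_class G t) * gcd d (card (cent G t))"
      by (simp add: gcd_mult_distrib_nat)
    also have "\<dots> dvd card (conj_class G t) * ?f t"
      using IH t by simp
    finally show "d dvd card (conj_class G t) * ?f t" .
  qed auto
  have "order G = sum ?f ?S"
    using order_eq_sum_cent [of "p ^ s" r] ord p by simp
  also have "?S = ?N \<union> ?Z" by auto
  also have "sum ?f (?N \<union> ?Z) = sum ?f ?N + sum ?f ?Z"
    by (rule sum.union_disjoint) auto
  also have "sum ?f ?Z = card ?Z * card {y \<in> carrier G. y [^] r = \<one>}"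
    by simp
  finally have "d dvd card ?Z * card {y \<in> carrier G. y [^] r = \<one>}"
    using N d by (metis (no_types, lifting) dvd_add_right_iff)
  moreover obtain i where "card ?Z = p ^ i"
    using prime_power_of_pow [OF subgroup_central_pow p(1), of "p ^ s" s] by blast
  then have "coprime d (card ?Z)"
    using p(2) d by (metis coprime_commute coprime_divisors coprime_power_left_iff dvd_refl)
  ultimately show ?thesis
    by (simp add: coprime_dvd_mult_right_iff)
qed

end

text \<open>
  The special case of a theorem of Frobenius that concerns the \<open>p'\<close>-elements: write every element
  as a commuting product of its \<open>p\<close>-part and its \<open>p'\<close>-part, sum over the \<open>p\<close>-parts, and use
  induction for the centralizers of the non-central ones.
\<close>

theorem Frobenius_coprime_part:
  fixes G :: "('a, 'b) monoid_scheme"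
  assumes "finite_group G" and p: "prime p" "coprime p r"
    and "order G dvd p ^ s * r" and "d dvd r" "d dvd order G"
  shows "d dvd card {y \<in> carrier G. y [^]\<^bsub>G\<^esub> r = \<one>\<^bsub>G\<^esub>}"
  using assms(1,4-6)
proof (induction "order G" arbitrary: G d rule: less_induct)
  case less
  interpret finite_group G by fact
  show ?case
  proof (rule Frobenius_coprime_part_step [OF p less.prems(2-4)])
    fix t assume t: "t \<in> carrier G" "cent G t \<noteq> carrier G"
    let ?H = "G\<lparr>carrier := cent G t\<rparr>"
    have H: "subgroup (cent G t) G" using t subgroup_cent by auto
    have card_H: "order ?H = card (cent G t)"
      by (simp add: order_def)
    have lt: "order ?H < order G"
      using t(2) cent_subset [of t] unfolding order_def
      by (simp add: psubset_card_mono psubset_eq)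
    have "gcd d (card (cent G t)) dvd card {y \<in> carrier ?H. y [^]\<^bsub>?H\<^esub> r = \<one>\<^bsub>?H\<^esub>}"
    proof (rule less.hyps [OF lt finite_group_subgroup [OF H]])
      show "order ?H dvd p ^ s * r"
        unfolding card_H using card_subgroup_dvd [OF H] less.prems(2) by (rule dvd_trans)
      show "gcd d (card (cent G t)) dvd r"
        using less.prems(3) by (rule dvd_trans [OF gcd_dvd1])
    qed (simp add: card_H)
    then show "gcd d (card (cent G t)) dvd card {y \<in> cent G t. y [^]\<^bsub>G\<^esub> r = \<one>\<^bsub>G\<^esub>}"
      by (simp add: nat_pow_consistent [symmetric])
  qed
qed

section \<open>Elements with maximal p-part\<close>

locale order_square = finite_group +
  fixes k n p s r b :: nat
  assumes prime_p: "prime p" and p_dvd_k: "p dvd k"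
    and n_def: "n = num_non_kth_powers G k" and order_n: "order G = n\<^sup>2"
    and order_ps: "order G = p ^ s * r" and coprime_pr: "coprime p r"
    and pow_all: "\<And>y. y \<in> carrier G \<Longrightarrow> y [^] (p ^ Suc b * r) = \<one>"
    and pow_ex: "\<exists>y\<in>carrier G. y [^] (p ^ b * r) \<noteq> \<one>"
begin

text \<open>The elements whose order is divisible by the maximal \<open>p\<close>-part \<open>p ^ Suc b\<close> of the element orders.\<close>

definition T :: "'a set"
  where "T = {y \<in> carrier G. y [^] (p ^ b * r) \<noteq> \<one>}"

lemma TD: "y \<in> T \<Longrightarrow> y \<in> carrier G" "y \<in> T \<Longrightarrow> y [^] (p ^ b * r) \<noteq> \<one>"
  by (auto simp: T_def)

lemma notT: "y \<in> carrier G \<Longrightarrow> y \<notin> T \<Longrightarrow> y [^] (p ^ b * r) = \<one>"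
  by (auto simp: T_def)

lemma finite_T [simp]: "finite T"
  by (rule finite_subset [of _ "carrier G"]) (auto simp: T_def)

lemma n_pos: "n > 0"
  using order_n order_pos by (metis gr0I power_zero_numeral less_irrefl)

lemma T_subset: "T \<subseteq> non_kth_powers G k"
proof
  fix y assume y: "y \<in> T"
  have "w [^] k \<notin> T" if w: "w \<in> carrier G" for w
  proof -
    obtain j where "k = p * j" using p_dvd_k by auto
    then have "(w [^] k) [^] (p ^ b * r) = w [^] ((p ^ Suc b * r) * j)"
      using w by (simp add: nat_pow_pow algebra_simps)
    also have "\<dots> = \<one>"
      by (rule pow_dvd_eq_one [OF w pow_all [OF w]]) simp
    finally show ?thesis by (simp add: T_def)
  qed
  with y show "y \<in> non_kth_powers G k"
    by (auto simp: non_kth_powers_def kth_powers_def TD)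
qed

lemma finite_non_kth_powers [simp]: "finite (non_kth_powers G k)"
  by (rule finite_subset [of _ "carrier G"]) (auto simp: non_kth_powers_def)

lemma card_T_le: "card T \<le> n"
  unfolding n_def num_non_kth_powers_def by (rule card_mono [OF _ T_subset]) simp

lemma conj_by_T [simp]: "g \<in> carrier G \<Longrightarrow> y \<in> carrier G \<Longrightarrow> conj_by G g y \<in> T \<longleftrightarrow> y \<in> T"
  by (simp add: T_def)

lemma conj_class_T: "y \<in> T \<Longrightarrow> conj_class G y \<subseteq> T"
  by (auto simp: conj_class_def TD)

lemma one_notT [simp]: "\<one> \<notin> T"
  by (simp add: T_def)

lemma mult_T:
  assumes "x \<in> T" "y \<in> cent G x" "y \<notin> T"
  shows "y \<otimes> x \<in> T"
proof -
  have y: "y \<in> carrier G" "y \<otimes> x = x \<otimes> y"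
    using assms by (auto simp: cent_def)
  show ?thesis
    using assms y TD [OF assms(1)] notT [OF y(1) assms(3)] by (simp add: T_def pow_mult_distrib)
qed

lemma pow_T:
  assumes "x \<in> T" "\<not> p dvd l"
  shows "x [^] l \<in> T"
proof -
  let ?w = "x [^] (p ^ b * r)"
  have x: "x \<in> carrier G" "?w \<noteq> \<one>"
    using TD assms(1) by auto
  have "?w [^] p = \<one>"
    using pow_all [OF x(1)] x by (simp add: nat_pow_pow algebra_simps)
  moreover have "coprime l p"
    using prime_p assms(2) by (metis coprime_commute prime_imp_coprime)
  ultimately have "?w [^] l \<noteq> \<one>"
    using pow_gcd_eq_one [of ?w l p] x by auto
  then show ?thesis
    using x by (simp add: T_def nat_pow_pow mult.commute)
qed

lemma p_element_T:
  assumes "y \<in> T"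
  shows "y [^] r \<in> T" "(y [^] r) [^] (p ^ Suc b) = \<one>"
proof -
  have "\<not> p dvd r"
    using coprime_pr prime_p by (metis coprime_absorb_left not_prime_unit)
  then show "y [^] r \<in> T" using assms pow_T by simp
  show "(y [^] r) [^] (p ^ Suc b) = \<one>"
    using TD(1) [OF assms] pow_all by (simp add: nat_pow_pow mult.commute)
qed

text \<open>For \<open>x \<in> T\<close>, each coset \<open>y\<langle>x\<rangle>\<close> in the centralizer of \<open>x\<close> has at most the proportion \<open>1 / p\<close>
  of its elements outside \<open>T\<close>.\<close>

lemma card_cent_diff_T:
  assumes x: "x \<in> T"
  shows "p * card (cent G x - T) \<le> card (cent G x)"
proof -
  let ?B = "cent G x - T"
  let ?A = "\<lambda>i::nat. (\<lambda>y. y \<otimes> x [^] i) ` ?B"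
  note xG = TD(1) [OF x]
  have disj: "?A i \<inter> ?A j = {}" if "i < j" "j < p" for i j
  proof (rule ccontr)
    assume "?A i \<inter> ?A j \<noteq> {}"
    then obtain y y' where y: "y \<in> ?B" "y' \<in> ?B" "y \<otimes> x [^] i = y' \<otimes> x [^] j"
      by auto
    have yG: "y \<in> carrier G" "y' \<in> carrier G"
      using y cent_closed by auto
    have "x [^] j = x [^] (j - i) \<otimes> x [^] i"
      using that xG by (simp add: nat_pow_mult)
    then have "y \<otimes> x [^] i = (y' \<otimes> x [^] (j - i)) \<otimes> x [^] i"
      using y yG xG by (simp add: m_assoc)
    then have eq: "y = y' \<otimes> x [^] (j - i)"
      using yG xG by simp
    have "\<not> p dvd j - i"
      using that by (metis dvd_imp_le less_imp_diff_less not_less zero_less_diff)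
    then have "x [^] (j - i) \<in> T"
      using pow_T x by blast
    moreover have "y' \<in> cent G (x [^] (j - i))"
      using y cent_subset_cent_pow xG by blast
    ultimately have "y \<in> T"
      using mult_T y eq by blast
    then show False using y by simp
  qed
  have card_A: "card (?A i) = card ?B" for i
  proof (intro card_image inj_onI)
    fix y y' assume "y \<in> ?B" "y' \<in> ?B" "y \<otimes> x [^] i = y' \<otimes> x [^] i"
    then show "y = y'"
      using right_cancel [of "x [^] i" y y'] xG cent_closed [of y x] cent_closed [of y' x] by auto
  qed
  have "(\<Sum>i<p. card (?A i)) = card (\<Union>i<p. ?A i)"
  proof (rule card_UN_disjoint [symmetric])
    show "\<forall>i\<in>{..<p}. \<forall>j\<in>{..<p}. i \<noteq> j \<longrightarrow> ?A i \<inter> ?A j = {}"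
    proof (intro ballI impI)
      fix i j assume "i \<in> {..<p}" "j \<in> {..<p}" "i \<noteq> j"
      then show "?A i \<inter> ?A j = {}"
        using disj [of i j] disj [of j i] by (cases "i < j") (simp_all add: Int_commute)
    qed
  qed auto
  also have "\<dots> \<le> card (cent G x)"
    using xG by (intro card_mono) (auto intro!: cent_mult cent_pow)
  finally show ?thesis by (simp add: card_A)
qed

lemma card_cent_split: "card (cent G x) = card (T \<inter> cent G x) + card (cent G x - T)"
  by (subst card_Un_disjoint [symmetric]) (auto intro!: arg_cong [where f = card])

lemma card_T_cent: "x \<in> T \<Longrightarrow> (p - 1) * card (cent G x) \<le> p * card (T \<inter> cent G x)"
proof -
  assume "x \<in> T"
  then have "p * card (cent G x) \<le> p * card (T \<inter> cent G x) + card (cent G x)"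
    using card_cent_diff_T [of x] card_cent_split [of x] by (simp add: algebra_simps)
  then show ?thesis by (simp add: diff_mult_distrib)
qed

lemma card_cent_le: "x \<in> T \<Longrightarrow> (p - 1) * card (cent G x) \<le> p * n"
proof -
  assume x: "x \<in> T"
  have "card (T \<inter> cent G x) \<le> n"
    using card_T_le by (meson card_mono finite_T inf_le1 le_trans)
  then show ?thesis using card_T_cent [OF x] by (meson le_trans mult_le_mono2)
qed

lemma class_equation: "x \<in> T \<Longrightarrow> card (conj_class G x) * card (cent G x) = n\<^sup>2"
  using card_conj_class TD order_n by simp

lemma card_class_ge:
  assumes x: "x \<in> T"
  shows "(p - 1) * n \<le> p * card (conj_class G x)"
proof -
  have "(p - 1) * n * n = card (conj_class G x) * ((p - 1) * card (cent G x))"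
    using class_equation [OF x] by (simp add: power2_eq_square algebra_simps)
  also have "\<dots> \<le> card (conj_class G x) * (p * n)"
    using card_cent_le [OF x] by simp
  finally have "((p - 1) * n) * n \<le> (p * card (conj_class G x)) * n"
    by (simp add: algebra_simps)
  then show ?thesis using n_pos by simp
qed

lemma half_class: "x \<in> T \<Longrightarrow> n \<le> 2 * card (conj_class G x)"
proof -
  assume x: "x \<in> T"
  obtain q where q: "p = Suc (Suc q)"
    using prime_ge_2_nat [OF prime_p] by (metis add_2_eq_Suc le_Suc_ex)
  have "(Suc q) * n \<le> Suc (Suc q) * card (conj_class G x)"
    using card_class_ge [OF x] q by simp
  also have "\<dots> \<le> Suc q * (2 * card (conj_class G x))"
    by simp
  finally show ?thesis
    by (metis Suc_mult_le_cancel1)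
qed

lemma two_classes_le:
  assumes "x \<in> T" "y \<in> T" "y \<notin> conj_class G x"
  shows "card (conj_class G x) + card (conj_class G y) \<le> card T"
proof -
  have "conj_class G x \<inter> conj_class G y = {}"
    using conj_class_disjoint assms TD by blast
  then have "card (conj_class G x) + card (conj_class G y) = card (conj_class G x \<union> conj_class G y)"
    by (simp add: card_Un_disjoint)
  also have "\<dots> \<le> card T"
    using assms conj_class_T by (intro card_mono) auto
  finally show ?thesis .
qed

lemma single_class:
  assumes x: "x \<in> T" and c: "card (cent G x) < 2 * n"
  shows "T = conj_class G x"
proof (rule ccontr)
  assume "T \<noteq> conj_class G x"
  then obtain y where y: "y \<in> T" "y \<notin> conj_class G x"
    using conj_class_T [OF x] by auto
  have pos: "card (conj_class G x) > 0"
    using self_conj_class [OF TD(1) [OF x]] by (auto simp: card_gt_0_iff simp del: self_conj_class)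
  have "n * n = card (conj_class G x) * card (cent G x)"
    using class_equation [OF x] by (simp add: power2_eq_square)
  also have "\<dots> < card (conj_class G x) * (2 * n)"
    using c pos by simp
  finally have "n < 2 * card (conj_class G x)"
    by (simp add: algebra_simps)
  then show False
    using half_class [OF y(1)] two_classes_le [OF x y] card_T_le by linarith
qed

lemma T_subset_cent:
  assumes "p = 2" "y \<in> T" "card (cent G y) \<ge> 2 * n"
  shows "T \<subseteq> cent G y"
proof -
  have "2 * n \<le> 2 * card (T \<inter> cent G y)"
    using card_T_cent [OF assms(2)] assms by simp
  then have "card T \<le> card (T \<inter> cent G y)"
    using card_T_le by simp
  then show ?thesis
    by (metis card_seteq finite_T inf.absorb_iff1 inf_le1)
qed

lemma large_cent_p_group:
  assumes x: "x \<in> T" "x [^] (p ^ Suc b) = \<one>" and c: "card (cent G x) \<ge> 2 * n"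
  shows "\<exists>i. order G = p ^ i"
proof -
  note xG = TD(1) [OF x(1)]
  have p2: "p = 2"
  proof (rule ccontr)
    assume "p \<noteq> 2"
    then have "3 \<le> p"
      using prime_ge_2_nat [OF prime_p] by simp
    then obtain q where q: "p = Suc (Suc (Suc q))"
      by (metis add_Suc le_Suc_ex numeral_3_eq_3 plus_nat.add_0)
    have "Suc (Suc q) * (2 * n) \<le> Suc (Suc (Suc q)) * n"
      using card_cent_le [OF x(1)] c q by (metis diff_Suc_1 le_trans mult_le_mono2)
    then show False using n_pos by (simp add: algebra_simps)
  qed
  have c2: "card (cent G x) = 2 * n"
    using card_cent_le [OF x(1)] c p2 by simp
  have cls: "2 * card (conj_class G x) = n"
    using class_equation [OF x(1)] c2 n_pos by (simp add: power2_eq_square)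
  have Tx: "T \<subseteq> cent G x"
    using T_subset_cent p2 x c by simp
  show ?thesis
  proof (rule prime_power_of_prime_divisors [OF prime_p order_pos])
    fix q assume q: "prime q" "q dvd order G"
    show "q = p"
    proof (rule ccontr)
      assume qp: "q \<noteq> p"
      have "q dvd card (cent G x)"
        using q c2 order_n prime_dvd_power [of q n 2] by auto
      then obtain u where u: "u \<in> cent G x" "u \<noteq> \<one>" "u [^] q = \<one>"
        using Cauchy_subgroup [OF subgroup_cent [OF xG] q(1)] by blast
      note uG = cent_closed [OF u(1)]
      have "q dvd r"
        using q qp order_ps prime_p by (metis prime_dvd_mult_iff prime_dvd_power primes_dvd_imp_eq)
      then have u_notT: "u \<notin> T"
        using pow_dvd_eq_one [OF uG u(3)] by (simp add: T_def)
      have u_pow: "(u [^] j) [^] (p ^ Suc b) \<noteq> \<one>" if "coprime j q" for j :: nat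
      proof
        assume "(u [^] j) [^] (p ^ Suc b) = \<one>"
        then have "u [^] (j * p ^ Suc b) = \<one>"
          using uG by (simp only: nat_pow_pow)
        moreover have "coprime (j * p ^ Suc b) q"
          using q qp prime_p primes_coprime that by auto
        ultimately show False
          using pow_gcd_eq_one [OF uG _ u(3)] u(2) by blast
      qed
      have cls_pow: "t [^] (p ^ Suc b) = \<one>" if "t \<in> conj_class G x" for t
        using that x(2) xG by (auto simp: conj_class_def simp del: power_Suc)
      have mult_pow: "t \<otimes> u [^] j \<notin> conj_class G x"
        if t: "t \<in> conj_class G x" "t \<otimes> u = u \<otimes> t" and j: "coprime j q" for t and j :: nat
      proof -
        have tG: "t \<in> carrier G"
          using t conj_class_subset xG by blast
        have "t \<in> cent G (u [^] j)"
          using t(2) tG uG cent_subset_cent_pow [of u j] by (auto simp: cent_def)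
        then have "(t \<otimes> u [^] j) [^] (p ^ Suc b) = t [^] (p ^ Suc b) \<otimes> (u [^] j) [^] (p ^ Suc b)"
          using tG uG by (intro pow_mult_distrib) (auto simp: cent_def)
        then show ?thesis
          using cls_pow [OF t(1)] cls_pow u_pow [OF j] uG by fastforce
      qed
      have coprime_q: "coprime 1 q" "coprime 2 q"
        using q(1) qp p2 primes_coprime [of 2 q] by auto
      let ?y = "x \<otimes> u"
      have xu: "x \<otimes> u = u \<otimes> x"
        using cent_comm [OF u(1)] by simp
      have yT: "?y \<in> T"
        using mult_T [OF x(1) u(1) u_notT] xu by simp
      have "?y \<notin> conj_class G x"
        using mult_pow [OF _ xu coprime_q(1)] xG uG by simp
      then have "2 * card (conj_class G ?y) \<le> n"
        using two_classes_le [OF x(1) yT] cls card_T_le by linarith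
      then have "(2 * card (conj_class G ?y)) * card (cent G ?y) \<le> n * card (cent G ?y)"
        by (rule mult_le_mono1)
      then have "n * (2 * n) \<le> n * card (cent G ?y)"
        unfolding mult.assoc class_equation [OF yT] by (simp add: power2_eq_square)
      then have Ty: "T \<subseteq> cent G ?y"
        using T_subset_cent [OF p2 yT] n_pos by simp
      have comm: "u \<in> cent G t" if t: "t \<in> T" for t
      proof -
        have tG: "t \<in> carrier G" using t TD by blast
        have "x \<in> cent G t" "?y \<in> cent G t"
          using t Tx Ty cent_sym xG uG by auto
        then have "inv x \<otimes> ?y \<in> cent G t"
          using tG cent_mult cent_inv by blast
        then show ?thesis
          using xG uG by (simp add: m_assoc [symmetric])
      qed
      let ?A = "conj_class G x"
      let ?B = "(\<lambda>t. t \<otimes> u) ` ?A" and ?D = "(\<lambda>t. t \<otimes> u \<otimes> u) ` ?A"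
      have AT: "?A \<subseteq> T" using conj_class_T x(1) by blast
      have AG: "?A \<subseteq> carrier G" using conj_class_subset xG by blast
      have tu: "t \<otimes> u \<in> T" if "t \<in> T" for t
        using mult_T [OF that comm [OF that] u_notT] cent_comm [OF comm [OF that]] by simp
      have sub: "?A \<union> (?B \<union> ?D) \<subseteq> T"
        using AT tu by auto
      have cB: "card ?B = card ?A" "card ?D = card ?A"
        using uG AG by (auto intro!: card_image inj_onI simp: subset_iff)
      have np: "t \<otimes> u \<notin> ?A" "t \<otimes> u \<otimes> u \<notin> ?A" if t: "t \<in> ?A" for t
      proof -
        have tG: "t \<in> carrier G" and tu: "t \<otimes> u = u \<otimes> t"
          using t AG AT cent_comm [OF comm, of t] by auto
        show "t \<otimes> u \<notin> ?A"
          using mult_pow [OF t tu coprime_q(1)] uG by simp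
        show "t \<otimes> u \<otimes> u \<notin> ?A"
          using mult_pow [OF t tu coprime_q(2)] uG tG by (simp add: numeral_2_eq_2 m_assoc)
      qed
      have BD: "?B \<inter> ?D = {}"
      proof (rule ccontr)
        assume "?B \<inter> ?D \<noteq> {}"
        then obtain t t' where "t \<in> ?A" "t' \<in> ?A" "t \<otimes> u = t' \<otimes> u \<otimes> u" by auto
        then have "t = t' \<otimes> u"
          using right_cancel [of u t "t' \<otimes> u"] AG uG by auto
        then show False using np \<open>t \<in> ?A\<close> \<open>t' \<in> ?A\<close> by blast
      qed
      have AB: "?A \<inter> ?B = {}" and AD: "?A \<inter> ?D = {}" using np by auto
      have "card (?A \<union> (?B \<union> ?D)) = 3 * card ?A"
        using AB BD AD cB by (simp add: card_Un_disjoint Int_Un_distrib)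
      then have "3 * card ?A \<le> n"
        using card_mono [OF finite_T sub] card_T_le by simp
      then show False
        using cls n_pos by linarith
    qed
  qed blast
qed

end

section \<open>A single class of elements with maximal p-part\<close>

locale order_square_class = order_square +
  fixes x
  assumes x_T: "x \<in> T" and x_pow: "x [^] (p ^ Suc b) = \<one>" and T_eq: "T = conj_class G x"
begin

abbreviation C :: "'a set"
  where "C \<equiv> cent G x"

lemma xG [simp]: "x \<in> carrier G"
  using TD x_T by blast

lemma T_obtain:
  assumes "y \<in> T"
  obtains g where "g \<in> carrier G" "y = conj_by G g x"
  using assms by (auto simp: T_eq conj_class_def)

lemma T_pow: "y \<in> T \<Longrightarrow> y [^] (p ^ Suc b) = \<one>"
  by (erule T_obtain) (use x_pow in \<open>simp del: power_Suc\<close>)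

lemma card_T_C: "card T * card C = n\<^sup>2"
  using class_equation x_T T_eq by simp

lemma card_T_pos: "card T > 0"
  using x_T by (auto simp: card_gt_0_iff)

lemma n_le_card_C: "n \<le> card C"
proof -
  have "n * n \<le> n * card C"
    using card_T_C card_T_le by (metis mult_le_mono1 power2_eq_square)
  then show ?thesis using n_pos by simp
qed

lemma card_T_le_C: "card T \<le> card C"
  using card_T_le n_le_card_C by simp

lemma card_C_power:
  obtains t where "card C = p ^ t"
proof (rule prime_power_of_prime_divisors [OF prime_p])
  show "card C > 0"
    using card_T_pos card_T_le_C by simp
  fix q assume q: "prime q" "q dvd card C"
  show "q = p"
  proof (rule ccontr)
    assume qp: "q \<noteq> p"
    obtain u where u: "u \<in> C" "u \<noteq> \<one>" "u [^] q = \<one>"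
      using Cauchy_subgroup [OF subgroup_cent [OF xG] q] .
    note uG = cent_closed [OF u(1)]
    have cop: "coprime (p ^ j) q" for j
      using q(1) qp prime_p primes_coprime by auto
    have "q dvd order G"
      using q(2) card_subgroup_dvd [OF subgroup_cent [OF xG]] by (rule dvd_trans)
    then have "q dvd r"
      using cop q(1) order_ps by (metis coprime_commute coprime_dvd_mult_right_iff)
    then have "u \<notin> T"
      using pow_dvd_eq_one [OF uG u(3)] by (simp add: T_def)
    then have "(u \<otimes> x) [^] (p ^ Suc b) = \<one>"
      using mult_T x_T u(1) T_pow by blast
    then have "u [^] (p ^ Suc b) = \<one>"
      using pow_mult_distrib [of u x] cent_comm [OF u(1)] uG x_pow by simp
    then show False
      using pow_gcd_eq_one [OF uG _ u(3)] cop u(2) by blast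
  qed
qed

lemma T_not_subset_C: "\<not> T \<subseteq> C"
proof
  assume TC: "T \<subseteq> C"
  have T_comm: "T \<subseteq> cent G y" if y: "y \<in> T" for y
  proof
    fix w assume w: "w \<in> T"
    obtain g where g: "g \<in> carrier G" "y = conj_by G g x"
      by (rule T_obtain [OF y])
    have wG: "w \<in> carrier G" using TD w by blast
    have "conj_by G (inv g) w \<in> T"
      using w wG g(1) by simp
    then have "conj_by G (inv g) w \<in> C"
      using TC by blast
    then have "conj_by G g (conj_by G (inv g) w) \<in> cent G y"
      unfolding g(2) cent_conj_by [OF g(1) xG] by (rule imageI)
    then show "w \<in> cent G y" using g wG by simp
  qed
  have CT: "C \<subseteq> cent G y" if y: "y \<in> T" for y
  proof
    fix w assume w: "w \<in> C"
    note wG = cent_closed [OF w] and yG = TD(1) [OF y]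
    show "w \<in> cent G y"
    proof (cases "w \<in> T")
      case True
      then show ?thesis using T_comm y by blast
    next
      case False
      then have "w \<otimes> x \<in> cent G y" "x \<in> cent G y"
        using mult_T [OF x_T w] T_comm [OF y] x_T by auto
      then have "(w \<otimes> x) \<otimes> inv x \<in> cent G y"
        using cent_mult cent_inv yG by blast
      then show ?thesis using wG by (simp add: m_assoc)
    qed
  qed
  have comm: "v \<otimes> w = w \<otimes> v" if v: "v \<in> C" and w: "w \<in> C" for v w
  proof -
    note vG = cent_closed [OF v]
    have vT: "T \<subseteq> cent G v"
      using CT v cent_sym TD by blast
    have "w \<in> cent G v"
    proof (cases "w \<in> T")
      case True
      then show ?thesis using vT by blast
    next
      case False
      then have "w \<otimes> x \<in> cent G v" "x \<in> cent G v"
        using mult_T [OF x_T w] vT x_T by auto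
      then have "(w \<otimes> x) \<otimes> inv x \<in> cent G v"
        using cent_mult cent_inv vG by blast
      then show ?thesis using cent_closed [OF w] by (simp add: m_assoc)
    qed
    then show ?thesis using cent_comm by simp
  qed
  have H: "subgroup (C - T) (G\<lparr>carrier := C\<rparr>)"
  proof -
    have "subgroup (C - T) G"
    proof (rule subgroupI)
      show "C - T \<noteq> {}" using cent_one [OF xG] one_notT by blast
      show "C - T \<subseteq> carrier G" using cent_subset by auto
      fix v assume v: "v \<in> C - T"
      then have vG: "v \<in> carrier G" using cent_closed by auto
      show "inv v \<in> C - T"
        using v vG cent_inv by (auto simp: T_def nat_pow_inv)
      fix w assume w: "w \<in> C - T"
      then have wG: "w \<in> carrier G" using cent_closed by auto
      show "v \<otimes> w \<in> C - T"
        using v w vG wG comm [of v w] cent_mult [of x v w]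
        by (auto simp: T_def pow_mult_distrib)
    qed
    then show ?thesis
      using subgroup_incl subgroup_cent xG by blast
  qed
  interpret H: finite_group "G\<lparr>carrier := C\<rparr>"
    by (rule finite_group_subgroup [OF subgroup_cent [OF xG]])
  have "card (C - T) dvd card C"
    using H.card_subgroup_dvd [OF H] by (simp add: order_def)
  then obtain q where q: "card C = card (C - T) * q" by auto
  define m where "m = card (C - T)"
  have split: "card C = card T + m"
    using card_cent_split [of x] TC by (simp add: m_def inf.absorb1)
  then have "card T + m = m * q"
    using q m_def by simp
  then have T_q: "card T = m * (q - 1)"
    by (simp add: diff_mult_distrib2)
  then have q2: "q \<ge> 2" and m0: "m > 0"
    using card_T_pos by (auto intro: ccontr)
  have sq: "n\<^sup>2 = m\<^sup>2 * ((q - 1) * q)"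
    using card_T_C T_q q m_def by (simp add: power2_eq_square algebra_simps)
  then have "m\<^sup>2 dvd n\<^sup>2" by simp
  then obtain w where "n = m * w"
    by (auto simp: pow_divides_pow_iff)
  then have w: "w\<^sup>2 = (q - 1) * q"
    using sq m0 by (simp add: power_mult_distrib)
  have "(q - 1)\<^sup>2 < w\<^sup>2" "w\<^sup>2 < q\<^sup>2"
    unfolding w using q2 by (simp_all add: power2_eq_square)
  then have "q - 1 < w" "w < q"
    by (meson power_less_imp_less_base zero_le)+
  then show False by simp
qed

lemma two_centralizers:
  assumes y: "y \<in> T" "y \<notin> C"
  shows "2 * card (T \<inter> C) \<le> card T + card (T \<inter> (C \<inter> cent G y))"
    and "p * card (C \<inter> cent G y) \<le> card C"
proof -
  have yG: "y \<in> carrier G" using TD y by blast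
  obtain g where g: "g \<in> carrier G" "y = conj_by G g x"
    by (rule T_obtain [OF y(1)])
  have "card (T \<inter> C) \<le> card (T \<inter> cent G y)"
    by (rule card_le_if_conj_by [OF _ _ g(1)])
      (use g TD in \<open>auto simp: cent_conj_by cent_closed\<close>)
  moreover have "card (T \<inter> C \<union> T \<inter> cent G y) \<le> card T"
    by (rule card_mono) auto
  moreover have "card (T \<inter> C) + card (T \<inter> cent G y)
      = card (T \<inter> C \<union> T \<inter> cent G y) + card (T \<inter> C \<inter> (T \<inter> cent G y))"
    by (rule card_Un_Int) auto
  moreover have "T \<inter> C \<inter> (T \<inter> cent G y) = T \<inter> (C \<inter> cent G y)" by auto
  ultimately show "2 * card (T \<inter> C) \<le> card T + card (T \<inter> (C \<inter> cent G y))"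
    by simp
  interpret H: finite_group "G\<lparr>carrier := C\<rparr>"
    by (rule finite_group_subgroup [OF subgroup_cent [OF xG]])
  let ?D = "C \<inter> cent G y"
  have "subgroup ?D G"
    by (rule subgroups_Inter_pair) (use yG in \<open>simp_all add: subgroup_cent\<close>)
  then have "subgroup ?D (G\<lparr>carrier := C\<rparr>)"
    using subgroup_incl subgroup_cent xG by auto
  then have dv: "card ?D dvd card C"
    using H.card_subgroup_dvd [of ?D] by (simp add: order_def)
  have "x \<notin> cent G y"
    using y(2) cent_sym [OF _ yG, of x] by auto
  then have "C \<noteq> ?D" using self_cent [OF xG] by (metis IntD2)
  then have "?D \<subset> C" by (simp add: psubset_eq)
  then have lt: "card ?D < card C"
    by (simp add: psubset_card_mono)
  obtain t where t: "card C = p ^ t" using card_C_power .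
  then obtain i where i: "i \<le> t" "card ?D = p ^ i"
    using dv divides_primepow_nat [OF prime_p] by auto
  then have "i < t" using lt t by (cases "i = t") auto
  then have "p ^ Suc i \<le> p ^ t"
    using prime_gt_0_nat [OF prime_p] by (intro power_increasing) auto
  then show "p * card ?D \<le> card C"
    using t i by simp
qed

lemma obtain_noncommuting:
  obtains y where "y \<in> T" "y \<notin> C"
  using T_not_subset_C by blast

lemma p_group_if_card_eq:
  assumes "card T = card C"
  shows "\<exists>i. order G = p ^ i"
proof -
  obtain t where "card C = p ^ t" using card_C_power .
  then have "order G = p ^ (t + t)"
    using card_T_C assms order_n by (simp add: power_add)
  then show ?thesis by blast
qed

lemma p_group_if_odd:
  assumes "p \<noteq> 2"
  shows "\<exists>i. order G = p ^ i"
proof (rule p_group_if_card_eq)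
  obtain y where y: "y \<in> T" "y \<notin> C" using obtain_noncommuting .
  have "3 \<le> p"
    using prime_ge_2_nat [OF prime_p] assms by simp
  then obtain q where q: "p = Suc (Suc (Suc q))"
    by (metis add_Suc le_Suc_ex numeral_3_eq_3 plus_nat.add_0)
  have "card (T \<inter> (C \<inter> cent G y)) \<le> card (C \<inter> cent G y)"
    by (rule card_mono) auto
  then have "p * card (T \<inter> (C \<inter> cent G y)) \<le> card C"
    using two_centralizers(2) [OF y] by (meson le_trans mult_le_mono2)
  then have "2 * (p * card (T \<inter> C)) \<le> p * card T + card C"
    using mult_le_mono2 [OF two_centralizers(1) [OF y], of p] by (simp add: algebra_simps)
  then have "2 * ((p - 1) * card C) \<le> p * card T + card C"
    using card_T_cent [OF x_T] by linarith
  then have "2 * (Suc (Suc q) * card C) \<le> p * card T + card C"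
    using q by simp
  then have "p * card C \<le> p * card T"
    unfolding q by (simp add: algebra_simps)
  then have "card C \<le> card T"
    using prime_gt_0_nat [OF prime_p] by simp
  then show "card T = card C"
    using card_T_le_C by simp
qed

end

locale order_square_class_2 = order_square_class +
  assumes p2: "p = 2" and T_less_C: "card T < card C"
begin

lemma half_C: "card C \<le> 2 * card (T \<inter> C)"
  using card_T_cent [OF x_T] p2 by simp

lemma b_pos: "b \<noteq> 0"
proof
  assume b: "b = 0"
  obtain t where t: "card C = 2 ^ t" using card_C_power p2 by auto
  interpret H: finite_group "G\<lparr>carrier := C\<rparr>"
    by (rule finite_group_subgroup [OF subgroup_cent [OF xG]])
  have "v = \<one>" if v: "v \<in> C" "v \<notin> T" for v
  proof -
    note vG = cent_closed [OF v(1)]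
    have "v [^] ((2::nat) ^ t) = \<one>"
      using H.pow_order_eq_1 [of v] v t nat_pow_consistent by (simp add: order_def)
    moreover have "v [^] r = \<one>"
      using notT [OF vG v(2)] b by simp
    moreover have "coprime ((2::nat) ^ t) r"
      using coprime_pr p2 by simp
    ultimately show ?thesis
      using pow_gcd_eq_one vG by blast
  qed
  then have "C - T = {\<one>}"
    using cent_one by auto
  then have split: "card C = card (T \<inter> C) + 1"
    using card_cent_split [of x] by simp
  obtain y where y: "y \<in> T" "y \<notin> C" using obtain_noncommuting .
  have "T \<inter> (C \<inter> cent G y) \<subset> C \<inter> cent G y"
    using cent_one [OF xG] cent_one [OF TD(1) [OF y(1)]] one_notT by blast
  then have "card (T \<inter> (C \<inter> cent G y)) < card (C \<inter> cent G y)"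
    by (simp add: psubset_card_mono)
  moreover have "2 * card (C \<inter> cent G y) \<le> card C"
    using two_centralizers(2) [OF y] p2 by simp
  ultimately show False
    using two_centralizers(1) [OF y] split T_less_C by linarith
qed

text \<open>If \<open>x\<close> had order at least 8, it would be conjugate to \<open>x z\<close> for the involution \<open>z\<close> in
  \<open>\<langle>x\<rangle>\<close>, and half of the coset of \<open>C\<close> that consists of the conjugating elements would lie in \<open>T\<close>.\<close>

lemma b_le_1: "b \<le> 1"
proof (rule ccontr)
  assume "\<not> b \<le> 1"
  then have b2: "b \<ge> 2" by simp
  define z where "z = x [^] ((2::nat) ^ b)"
  have zG: "z \<in> carrier G" by (simp add: z_def)
  have zC: "z \<in> C" by (simp add: z_def cent_pow)
  have x_pow2: "x [^] i = \<one>" if "2 ^ Suc b dvd i" for i :: nat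
    using pow_dvd_eq_one [OF xG _ that] x_pow p2 by simp
  have z2: "z \<otimes> z = \<one>"
    using x_pow2 [of "2 ^ Suc b"] by (simp add: z_def nat_pow_mult mult_2)
  have "x [^] (1 + (2::nat) ^ b) \<in> T"
    using p2 b2 by (intro pow_T [OF x_T]) simp
  then have "x \<otimes> z \<in> T"
    using nat_pow_mult [OF xG, of 1 "2 ^ b"] by (simp add: z_def)
  then obtain g where g: "g \<in> carrier G" "x \<otimes> z = conj_by G g x"
    by (rule T_obtain)
  define K where "K = {h \<in> carrier G. conj_by G h x = x \<otimes> z}"
  have K_G: "K \<subseteq> carrier G" by (auto simp: K_def)
  then have finK: "finite K" using finite_subset finite_carrier by blast
  have xz: "z \<otimes> x = x \<otimes> z"
    using cent_comm [OF zC] .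
  have hx: "h \<otimes> x \<in> K" if "h \<in> K" for h
  proof -
    have "conj_by G x x = x" by (simp add: conj_by_def m_assoc)
    then show ?thesis
      using that by (simp add: K_def conj_by_conj_by [symmetric])
  qed
  have disj: "K \<inter> C = {}"
  proof -
    have "z \<noteq> \<one>"
    proof
      assume "z = \<one>"
      then have "x [^] (2 ^ b * r) = \<one>"
        using pow_dvd_eq_one [OF xG, of "2 ^ b"] by (simp add: z_def)
      then show False using TD(2) [OF x_T] p2 by simp
    qed
    then have "x \<otimes> z \<noteq> x"
      using zG by (metis l_cancel_one xG)
    moreover have "conj_by G h x = x" if "h \<in> C" for h
      using conj_by_eq_self_iff that cent_closed by auto
    ultimately show ?thesis by (auto simp: K_def)
  qed
  have card_K: "card C \<le> card K"
  proof (rule card_inj_on_le [where f = "\<lambda>y. g \<otimes> y"])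
    show "inj_on ((\<otimes>) g) C"
      using g cent_subset by (auto intro!: inj_onI simp: cent_closed)
    show "(\<otimes>) g ` C \<subseteq> K"
    proof (rule image_subsetI)
      fix y assume y: "y \<in> C"
      then have "conj_by G y x = x"
        using conj_by_eq_self_iff cent_closed by auto
      then show "g \<otimes> y \<in> K"
        using g cent_closed [OF y] by (simp add: K_def conj_by_conj_by [symmetric])
    qed
  qed (rule finK)
  have hT: "h \<in> T \<or> h \<otimes> x \<in> T" if h: "h \<in> K" for h
  proof (rule ccontr)
    assume nT: "\<not> ?thesis"
    have hG: "h \<in> carrier G" and cx: "conj_by G h x = x \<otimes> z"
      using h by (auto simp: K_def)
    define e where "e = (2 + 2 ^ b :: nat)"
    have hxh: "h \<otimes> x = x \<otimes> z \<otimes> h"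
      using cx hG zG unfolding conj_by_def by (metis inv_solve_right' m_closed xG)
    have cz: "conj_by G h z = z"
    proof -
      have "conj_by G h z = (x \<otimes> z) [^] ((2::nat) ^ b)"
        using hG cx by (simp add: z_def conj_by_pow)
      also have "\<dots> = z \<otimes> z [^] ((2::nat) ^ b)"
        using zG xz by (simp add: pow_mult_distrib) (simp add: z_def)
      also have "z [^] ((2::nat) ^ b) = \<one>"
      proof (rule pow_dvd_eq_one [OF zG])
        show "z [^] (2::nat) = \<one>"
          using zG z2 by (simp add: numeral_2_eq_2)
      qed (use b2 in simp)
      finally show ?thesis using zG by simp
    qed
    have "conj_by G (h \<otimes> h) x = x"
    proof -
      have "conj_by G (h \<otimes> h) x = conj_by G h (x \<otimes> z)"
        using hG cx by (simp add: conj_by_conj_by [symmetric])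
      also have "\<dots> = x \<otimes> z \<otimes> z"
        using hG zG cx cz by (simp add: conj_by_mult)
      finally show ?thesis using zG z2 by (simp add: m_assoc)
    qed
    then have hhC: "h \<otimes> h \<in> C"
      using hG by (simp add: conj_by_eq_self_iff)
    have "(h \<otimes> x) \<otimes> (h \<otimes> x) = x \<otimes> z \<otimes> h \<otimes> (h \<otimes> x)"
      using hxh by simp
    also have "\<dots> = x \<otimes> z \<otimes> ((h \<otimes> h) \<otimes> x)"
      using hG zG by (simp add: m_assoc)
    also have "\<dots> = x \<otimes> z \<otimes> (x \<otimes> (h \<otimes> h))"
      using cent_comm [OF hhC] by simp
    also have "\<dots> = (x \<otimes> x \<otimes> z) \<otimes> (h \<otimes> h)"
    proof -
      have "x \<otimes> z \<otimes> x = x \<otimes> x \<otimes> z"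
        using zG xz by (simp add: m_assoc)
      then show ?thesis
        using hG zG by (simp add: m_assoc [symmetric])
    qed
    also have "x \<otimes> x \<otimes> z = x [^] e"
    proof -
      have "x [^] (2::nat) = x \<otimes> x"
        by (simp add: numeral_2_eq_2)
      then show ?thesis
        using nat_pow_mult [OF xG, of 2 "2 ^ b"] by (simp add: z_def e_def)
    qed
    finally have sq: "(h \<otimes> x) [^] (2::nat) = x [^] e \<otimes> h [^] (2::nat)"
      using hG by (simp add: numeral_2_eq_2)
    have comm: "x [^] e \<otimes> h [^] (2::nat) = h [^] (2::nat) \<otimes> x [^] e"
      using cent_subset_cent_pow [OF xG, of e] hhC hG
      by (auto simp: numeral_2_eq_2 cent_def)
    define j where "j = 2 ^ (b - 1) * r"
    have E: "2 ^ b * r = 2 * j"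
      using b2 by (simp add: j_def power_eq_if)
    have "(h \<otimes> x) [^] (2 ^ b * r) = (x [^] e \<otimes> h [^] (2::nat)) [^] j"
      unfolding E using hG by (simp add: nat_pow_pow [symmetric] sq)
    also have "\<dots> = x [^] (e * j) \<otimes> h [^] (2 ^ b * r)"
      unfolding E using hG pow_mult_distrib [OF comm] by (simp add: nat_pow_pow)
    finally have "x [^] (e * j) = \<one>"
      using nT notT [of h] notT [of "h \<otimes> x"] hG p2 by simp
    moreover have "e * j = 2 ^ b * r + 2 ^ Suc b * (2 ^ (b - 2) * r)"
    proof -
      obtain b' where "b = Suc (Suc b')"
        using b2 by (metis add_2_eq_Suc le_Suc_ex)
      then show ?thesis
        by (simp add: e_def j_def algebra_simps)
    qed
    moreover have "x [^] (2 ^ Suc b * (2 ^ (b - 2) * r)) = \<one>"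
      by (rule x_pow2) simp
    ultimately have "x [^] (2 ^ b * r) = \<one>"
      by (simp add: nat_pow_mult [symmetric] del: power_Suc)
    then show False using TD(2) [OF x_T] p2 by simp
  qed
  have "card (K - T) \<le> card (K \<inter> T)"
  proof (rule card_inj_on_le [where f = "\<lambda>h. h \<otimes> x"])
    show "inj_on (\<lambda>h. h \<otimes> x) (K - T)"
      using K_G by (intro inj_onI) (auto simp: subset_iff)
    show "(\<lambda>h. h \<otimes> x) ` (K - T) \<subseteq> K \<inter> T"
      using hx hT by auto
  qed (use finK in auto)
  moreover have "card K = card (K - T) + card (K \<inter> T)"
    using finK by (subst card_Un_disjoint [symmetric]) (auto intro!: arg_cong [where f = card])
  moreover have "card (K \<inter> T) + card (T \<inter> C) = card (K \<inter> T \<union> T \<inter> C)"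
    using disj by (subst card_Un_disjoint) auto
  moreover have "card (K \<inter> T \<union> T \<inter> C) \<le> card T"
    by (rule card_mono) auto
  ultimately show False
    using half_C card_K T_less_C by linarith
qed

lemma b_eq_1: "b = 1"
  using b_pos b_le_1 by simp

end

section \<open>Elements of order 4\<close>

context order_square_class_2
begin

definition involution :: 'a
  where "involution = x [^] (2::nat)"

lemma involution_closed [simp]: "involution \<in> carrier G"
  by (simp add: involution_def)

lemma T_iff: "y \<in> T \<longleftrightarrow> y \<in> carrier G \<and> y [^] (2 * r) \<noteq> \<one>"
  unfolding T_def by (simp add: p2 b_eq_1)

lemma T_pow_4: "y \<in> T \<Longrightarrow> y [^] (4::nat) = \<one>"
  using T_pow [of y] by (simp add: p2 b_eq_1)

lemma involution_pow_r: "involution [^] r \<noteq> \<one>"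
  using x_T by (simp add: T_iff involution_def nat_pow_pow)

lemma even_order_power:
  assumes v: "v \<in> carrier G" and w: "(v [^] k) [^] r \<noteq> \<one>"
  shows "v \<in> T" "k mod 4 = 2"
proof -
  obtain j where j: "k = 2 * j" using p_dvd_k p2 by auto
  show vT: "v \<in> T"
  proof (rule ccontr)
    assume "v \<notin> T"
    then have "v [^] (2 * r) = \<one>" using v T_iff by blast
    then have "v [^] (k * r) = \<one>"
      using pow_dvd_eq_one [OF v, of "2 * r"] j by simp
    then show False using w v by (simp add: nat_pow_pow)
  qed
  show "k mod 4 = 2"
  proof (rule ccontr)
    assume "k mod 4 \<noteq> 2"
    then have "4 dvd k" using j by presburger
    then have "v [^] k = \<one>"
      using pow_dvd_eq_one [OF v T_pow_4 [OF vT]] by blast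
    then show False using w by simp
  qed
qed

lemma pow_k_eq_square:
  assumes "k mod 4 = 2" "v \<in> T"
  shows "v [^] k = v [^] (2::nat)"
  by (rule pow_cong [OF TD(1) [OF assms(2)] T_pow_4 [OF assms(2)]])
    (use assms in \<open>simp add: cong_def\<close>)

lemma even_order_powers:
  "kth_powers G k - {y \<in> carrier G. y [^] r = \<one>} = {} \<or>
   kth_powers G k - {y \<in> carrier G. y [^] r = \<one>} = conj_class G involution"
  (is "?Q = {} \<or> _")
proof (cases "?Q = {}")
  case False
  then obtain v where "v \<in> carrier G" "(v [^] k) [^] r \<noteq> \<one>"
    by (auto simp: kth_powers_def)
  then have k4: "k mod 4 = 2" using even_order_power by blast
  have "?Q = conj_class G involution"
  proof
    show "?Q \<subseteq> conj_class G involution"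
    proof
      fix w assume "w \<in> ?Q"
      then obtain v where v: "v \<in> carrier G" "w = v [^] k" "(v [^] k) [^] r \<noteq> \<one>"
        by (auto simp: kth_powers_def)
      then have vT: "v \<in> T" using even_order_power by blast
      obtain g where g: "g \<in> carrier G" "v = conj_by G g x"
        by (rule T_obtain [OF vT])
      have "w = conj_by G g involution"
        using g pow_k_eq_square [OF k4 vT] v by (simp add: involution_def conj_by_pow)
      then show "w \<in> conj_class G involution"
        using g by (auto simp: conj_class_def)
    qed
    show "conj_class G involution \<subseteq> ?Q"
    proof
      fix w assume "w \<in> conj_class G involution"
      then obtain g where g: "g \<in> carrier G" "w = conj_by G g involution"
        by (auto simp: conj_class_def)
      have "conj_by G g x \<in> T" using g x_T by simp
      then have "w = conj_by G g x [^] k"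
        using pow_k_eq_square [OF k4] g by (simp add: involution_def conj_by_pow)
      moreover have "w [^] r \<noteq> \<one>"
        using g involution_pow_r by simp
      ultimately show "w \<in> ?Q"
        using g by (auto simp: kth_powers_def)
    qed
  qed
  then show ?thesis ..
qed simp

lemma card_cent_diff_T_bound:
  "card (C - T) * card (conj_class G involution) \<le> card T"
proof -
  let ?F = "\<lambda>y. {t \<in> T. t [^] (2::nat) = y}"
  have le: "card (C - T) \<le> card (?F y)" if y: "y \<in> conj_class G involution" for y
  proof -
    obtain t where t: "card C = 2 ^ t" using card_C_power p2 by auto
    interpret H: finite_group "G\<lparr>carrier := C\<rparr>"
      by (rule finite_group_subgroup [OF subgroup_cent [OF xG]])
    have sq: "v [^] (2::nat) = \<one>" if v: "v \<in> C" "v \<notin> T" for v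
    proof -
      note vG = cent_closed [OF v(1)]
      have "v [^] ((2::nat) ^ t) = \<one>"
        using H.pow_order_eq_1 [of v] v t nat_pow_consistent by (simp add: order_def)
      then have "(v [^] (2::nat)) [^] ((2::nat) ^ t) = \<one>"
        using vG by (simp add: nat_pow_pow pow_dvd_eq_one [of v "2 ^ t"])
      moreover have "(v [^] (2::nat)) [^] r = \<one>"
        using v vG T_iff by (simp add: nat_pow_pow)
      moreover have "coprime ((2::nat) ^ t) r"
        using coprime_pr p2 by simp
      ultimately show ?thesis
        using pow_gcd_eq_one vG nat_pow_closed by blast
    qed
    have "card (C - T) \<le> card (?F involution)"
    proof (rule card_inj_on_le [where f = "\<lambda>v. v \<otimes> x"])
      show "inj_on (\<lambda>v. v \<otimes> x) (C - T)"
        using cent_subset [of x] by (intro inj_onI) (auto simp: subset_iff)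
      show "(\<lambda>v. v \<otimes> x) ` (C - T) \<subseteq> ?F involution"
      proof (rule image_subsetI)
        fix v assume v: "v \<in> C - T"
        then have vC: "v \<in> C" "v \<notin> T" by auto
        have "(v \<otimes> x) [^] (2::nat) = v [^] (2::nat) \<otimes> x [^] (2::nat)"
          by (rule pow_mult_distrib [OF cent_comm [OF vC(1)] cent_closed [OF vC(1)] xG])
        then show "v \<otimes> x \<in> ?F involution"
          using mult_T [OF x_T vC] sq [OF vC] by (simp add: involution_def)
      qed
    qed simp
    also obtain g where g: "g \<in> carrier G" "y = conj_by G g involution"
      using y by (auto simp: conj_class_def)
    have "card (?F involution) \<le> card (?F y)"
      by (rule card_le_if_conj_by [OF _ _ g(1)])
        (use g TD in \<open>auto simp: conj_by_pow [symmetric]\<close>)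
    finally show ?thesis .
  qed
  have "card (C - T) * card (conj_class G involution) = (\<Sum>y\<in>conj_class G involution. card (C - T))"
    by simp
  also have "\<dots> \<le> (\<Sum>y\<in>conj_class G involution. card (?F y))"
    by (rule sum_mono) (rule le)
  also have "\<dots> = card (\<Union>y\<in>conj_class G involution. ?F y)"
    by (rule card_UN_disjoint [symmetric]) auto
  also have "\<dots> \<le> card T"
    by (rule card_mono) auto
  finally show ?thesis .
qed

lemma three_card_C_le: "3 * card C \<le> 2 * card T + 4 * card (C - T)"
proof -
  obtain y where y: "y \<in> T" "y \<notin> C" using obtain_noncommuting .
  have "card (T \<inter> (C \<inter> cent G y)) \<le> card (C \<inter> cent G y)"
    by (rule card_mono) auto
  moreover have "2 * card (C \<inter> cent G y) \<le> card C"
    using two_centralizers(2) [OF y] p2 by simp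
  ultimately show ?thesis
    using two_centralizers(1) [OF y] card_cent_split [of x] by linarith
qed

lemma p_group_if_even:
  assumes k_r: "coprime k r"
  shows "\<exists>i. order G = p ^ i"
proof -
  have "n \<noteq> 0" "\<not> is_unit (2::nat)" using n_pos by auto
  then obtain w where w: "\<not> 2 dvd w" "n = 2 ^ multiplicity 2 n * w"
    using multiplicity_decompose' by metis
  define i where "i = multiplicity 2 n"
  have n_i: "n = 2 ^ i * w" using w i_def by simp
  have cop_w: "coprime (2 ^ j) w" for j
    using w(1) by (simp add: coprime_left_2_iff_odd)
  have order_w: "2 ^ s * r = 2 ^ (2 * i) * w\<^sup>2"
    using order_n order_ps p2 n_i by (simp add: power_mult_distrib power_mult [symmetric] mult.commute)
  have "r = w\<^sup>2"
  proof (rule dvd_antisym)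
    have "coprime r (2 ^ (2 * i))"
      using coprime_pr p2 by (simp add: coprime_commute)
    then show "r dvd w\<^sup>2"
      using order_w by (metis coprime_dvd_mult_right_iff dvd_triv_right)
    have "coprime (w\<^sup>2) (2 ^ s)"
      using cop_w by (simp add: coprime_commute)
    then show "w\<^sup>2 dvd r"
      using order_w by (metis coprime_dvd_mult_right_iff dvd_triv_right)
  qed
  let ?O = "{y \<in> carrier G. y [^] r = \<one>}"
  let ?Q = "kth_powers G k - ?O"
  have K_G: "kth_powers G k \<subseteq> carrier G" by (auto simp: kth_powers_def)
  then have fK: "finite (kth_powers G k)" using finite_subset finite_carrier by blast
  have OK: "?O \<subseteq> kth_powers G k"
  proof
    fix y assume "y \<in> ?O"
    then obtain v where "v \<in> carrier G" "v [^] k = y"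
      using coprime_pow_root [of y r k] k_r by auto
    then show "y \<in> kth_powers G k" by (auto simp: kth_powers_def)
  qed
  have "n = card (carrier G - kth_powers G k)"
    by (simp add: n_def num_non_kth_powers_def non_kth_powers_def)
  then have "n = order G - card (kth_powers G k)"
    using card_Diff_subset [OF fK K_G] by (simp add: order_def)
  moreover have "card (kth_powers G k) \<le> order G"
    unfolding order_def by (rule card_mono [OF _ K_G]) simp
  moreover have "card (kth_powers G k) = card ?O + card ?Q"
    using OK fK by (subst card_Un_disjoint [symmetric]) (auto intro!: arg_cong [where f = card] finite_subset [OF OK fK])
  ultimately have count: "n\<^sup>2 = card ?O + (n + card ?Q)"
    using order_n by simp
  have "r dvd card ?O"
    using Frobenius_coprime_part [OF finite_group_axioms prime_p coprime_pr, of s r] order_ps by simp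
  moreover have "r dvd n\<^sup>2"
    using order_n order_ps by (metis dvd_triv_right)
  ultimately have "r dvd n + card ?Q"
    unfolding count by (simp only: dvd_add_right_iff)
  then have r_dvd: "w\<^sup>2 dvd n + card ?Q"
    using \<open>r = w\<^sup>2\<close> by simp
  have "w = 1"
  proof (rule ccontr)
    assume "w \<noteq> 1"
    then have w3: "w \<ge> 3"
      using w(1) by (cases "w = 0 \<or> w = 2") auto
    from even_order_powers show False
    proof
      assume "?Q = {}"
      then have "card ?Q = 0"
        by (simp only: card.empty)
      then have "w * w dvd 2 ^ i * w"
        using r_dvd n_i by (simp add: power2_eq_square del: card_0_eq)
      then have "w dvd 2 ^ i" using w3 by simp
      then show False
        using cop_w [of i] \<open>w \<noteq> 1\<close> by (metis coprime_absorb_right nat_dvd_1_iff_1)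
    next
      assume Q: "?Q = conj_class G involution"
      let ?z = "card (conj_class G involution)"
      have "w dvd n + ?z"
        using r_dvd Q by (metis dvd_trans dvd_triv_left power2_eq_square)
      moreover have "w dvd n" using n_i by simp
      ultimately have "w dvd ?z"
        by (simp add: dvd_add_right_iff)
      moreover have "?z > 0"
        using self_conj_class [OF involution_closed] by (auto simp: card_gt_0_iff simp del: self_conj_class)
      ultimately have "w \<le> ?z" by (rule dvd_imp_le)
      then have "card (C - T) * w \<le> card (C - T) * ?z" by simp
      also note card_cent_diff_T_bound
      finally have e: "card (C - T) * w \<le> card T" .
      have "3 * card C * w \<le> 2 * card T * w + 4 * (card (C - T) * w)"
        using mult_le_mono1 [OF three_card_C_le, of w] by (simp add: algebra_simps)
      then have main: "3 * card C * w \<le> 2 * card T * w + 4 * card T"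
        using e by linarith
      have "w = 3"
      proof (rule ccontr)
        assume "w \<noteq> 3"
        then have "w \<ge> 5" using w3 w(1) by (cases "w = 4") auto
        then obtain j where j: "w = 5 + j" using le_Suc_ex by blast
        have "3 * card T * w \<le> 3 * card C * w"
          using T_less_C by simp
        then have "3 * card T * w \<le> 2 * card T * w + 4 * card T"
          using main by linarith
        then show False
          using card_T_pos unfolding j by (simp add: algebra_simps)
      qed
      obtain t where t: "card C = 2 ^ t" using card_C_power p2 by auto
      have mc: "card T * 2 ^ t = 2 ^ (2 * i) * 9"
        using card_T_C t n_i \<open>w = 3\<close> by (simp add: power_mult_distrib power_mult [symmetric] mult.commute)
      have "coprime ((2::nat) ^ t) 9"
        by (simp add: coprime_left_2_iff_odd)
      then have "(2::nat) ^ t dvd 2 ^ (2 * i)"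
        using mc by (metis coprime_dvd_mult_left_iff dvd_triv_right)
      then obtain j where j: "2 * i = t + j"
        by (metis le_Suc_ex power_dvd_imp_le one_less_numeral_iff semiring_norm(76))
      then have T9: "card T = 2 ^ j * 9"
        using mc by (simp add: power_add)
      have "9 * 2 ^ t \<le> 10 * (2 ^ j * (9::nat))"
        using main \<open>w = 3\<close> t T9 by simp
      then have up: "(2::nat) ^ t \<le> 10 * 2 ^ j" by simp
      have lo: "2 ^ j * 9 < (2::nat) ^ t"
        using T_less_C t T9 by simp
      show False
      proof (cases "t \<le> j + 3")
        case True
        then have "(2::nat) ^ t \<le> 2 ^ (j + 3)" by (intro power_increasing) auto
        then show False using lo by (simp add: power_add)
      next
        case False
        then have "(2::nat) ^ (j + 4) \<le> 2 ^ t" by (intro power_increasing) auto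
        moreover have "(2::nat) ^ (j + 4) = 16 * 2 ^ j" by (simp add: power_add)
        moreover have "(2::nat) ^ j > 0" by simp
        ultimately show False using up by linarith
      qed
    qed
  qed
  then have "order G = p ^ (i * 2)"
    using order_n n_i p2 by (simp add: power_mult)
  then show ?thesis by blast
qed

end

context finite_group
begin

lemma order_square_exists:
  assumes p: "prime p" "p dvd k" "p dvd order G" and n: "order G = (num_non_kth_powers G k)\<^sup>2"
  obtains s r b where "order_square G k (num_non_kth_powers G k) p s r b"
proof -
  have "order G \<noteq> 0" "\<not> is_unit p"
    using order_pos p(1) not_prime_unit by auto
  then obtain r where r: "\<not> p dvd r" "order G = p ^ multiplicity p (order G) * r"
    using multiplicity_decompose' by metis
  define s where "s = multiplicity p (order G)"
  have ord: "order G = p ^ s * r" using r s_def by simp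
  have cop: "coprime p r" using p(1) r(1) prime_imp_coprime by blast
  define P where "P = (\<lambda>a. \<forall>y\<in>carrier G. y [^] (p ^ a * r) = \<one>)"
  have "P s" unfolding P_def using pow_order_eq_1 ord by simp
  define a where "a = (LEAST a. P a)"
  have Pa: "P a" unfolding a_def by (rule LeastI [of P, OF \<open>P s\<close>])
  have "a \<noteq> 0"
  proof
    assume "a = 0"
    obtain u where u: "u \<in> carrier G" "u \<noteq> \<one>" "u [^] p = \<one>"
      using Cauchy [OF p(1,3)] .
    then have "u [^] r = \<one>" using Pa \<open>a = 0\<close> by (simp add: P_def)
    then show False using pow_gcd_eq_one [OF u(1,3) _ cop] u(2) by blast
  qed
  then obtain b where b: "a = Suc b" using not0_implies_Suc by blast
  have "\<not> P b"
    using not_less_Least [of b P] b unfolding a_def by simp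
  then have "order_square G k (num_non_kth_powers G k) p s r b"
    using p n ord cop Pa b finite_group_axioms
    unfolding order_square_def order_square_axioms_def P_def by auto
  then show thesis using that by blast
qed

end

context order_square
begin

lemma obtain_p_element:
  obtains x where "x \<in> T" "x [^] (p ^ Suc b) = \<one>"
proof -
  obtain y where "y \<in> T" using pow_ex by (auto simp: T_def)
  then show thesis using p_element_T that by blast
qed

text \<open>Otherwise \<open>p\<close>-elements and \<open>q\<close>-elements that are not \<open>k\<close>-th powers would form two disjoint
  classes with at least \<open>n / 2\<close> and \<open>2 n / 3\<close> elements.\<close>

lemma coprime_k_r:
  assumes p2: "p = 2"
  shows "coprime k r"
proof (rule ccontr)
  assume "\<not> coprime k r"
  then obtain q where q: "prime q" "q dvd k" "q dvd r"
    by (metis coprime_iff_gcd_eq_1 dvd_trans gcd_dvd1 gcd_dvd2 prime_factor_nat)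
  have "q \<noteq> p"
  proof
    assume "q = p"
    then have "is_unit p"
      using coprime_pr q(3) by (simp add: coprime_absorb_left)
    then show False using prime_p by simp
  qed
  have "q dvd order G" using q order_ps by simp
  then obtain s' r' b' where "order_square G k n q s' r' b'"
    using order_square_exists [OF q(1,2)] order_n n_def by blast
  then interpret Q: order_square G k n q s' r' b' .
  obtain x where x: "x \<in> T" "x [^] (p ^ Suc b) = \<one>" using obtain_p_element .
  obtain y where y: "y \<in> Q.T" "y [^] (q ^ Suc b') = \<one>" using Q.obtain_p_element .
  note xG = TD(1) [OF x(1)] and yG = Q.TD(1) [OF y(1)]
  have "y \<notin> conj_class G x"
  proof
    assume "y \<in> conj_class G x"
    then have "y [^] (p ^ Suc b) = \<one>"
      using x(2) xG by (auto simp: conj_class_def simp del: power_Suc)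
    moreover have "coprime (p ^ Suc b) (q ^ Suc b')"
      using \<open>q \<noteq> p\<close> q(1) prime_p primes_coprime by auto
    ultimately have "y = \<one>" using pow_gcd_eq_one yG y(2) by blast
    then show False using y(1) Q.one_notT by simp
  qed
  then have "conj_class G x \<inter> conj_class G y = {}"
    using conj_class_disjoint xG yG by blast
  then have "card (conj_class G x) + card (conj_class G y) = card (conj_class G x \<union> conj_class G y)"
    by (simp add: card_Un_disjoint)
  also have "\<dots> \<le> n"
    unfolding n_def num_non_kth_powers_def
    using conj_class_T [OF x(1)] T_subset Q.conj_class_T [OF y(1)] Q.T_subset
    by (intro card_mono) auto
  finally have "card (conj_class G x) + card (conj_class G y) \<le> n" .
  moreover have "n \<le> 2 * card (conj_class G x)"
    using half_class x(1) .
  moreover have "2 * n \<le> 3 * card (conj_class G y)"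
  proof (rule ccontr)
    assume less: "\<not> ?thesis"
    have "3 \<le> q"
      using prime_ge_2_nat [OF q(1)] \<open>q \<noteq> p\<close> p2 by simp
    then obtain j where j: "q = Suc (Suc (Suc j))"
      by (metis add_Suc le_Suc_ex numeral_3_eq_3 plus_nat.add_0)
    have "(2 + j) * n \<le> (3 + j) * card (conj_class G y)"
      using Q.card_class_ge [OF y(1)] unfolding j by (simp add: algebra_simps)
    then have "3 * ((2 + j) * n) \<le> (3 + j) * (3 * card (conj_class G y))"
      by (simp add: algebra_simps)
    also have "\<dots> < (3 + j) * (2 * n)"
      using less by simp
    finally show False by (simp add: algebra_simps)
  qed
  ultimately show False using n_pos by linarith
qed

lemma p_group: "\<exists>i. order G = p ^ i"
proof -
  obtain x where x: "x \<in> T" "x [^] (p ^ Suc b) = \<one>" using obtain_p_element .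
  show ?thesis
  proof (cases "card (cent G x) < 2 * n")
    case False
    then show ?thesis using large_cent_p_group x by simp
  next
    case True
    interpret order_square_class G k n p s r b x
      by unfold_locales (use x single_class [OF x(1) True] in auto)
    show ?thesis
    proof (cases "p = 2 \<and> card T \<noteq> card C")
      case False
      then show ?thesis using p_group_if_odd p_group_if_card_eq by blast
    next
      case p2: True
      interpret order_square_class_2 G k n p s r b x
        by unfold_locales (use p2 card_T_le_C in auto)
      show ?thesis using p_group_if_even coprime_k_r p2 by blast
    qed
  qed
qed

end

context finite_group
begin

text \<open>In a \<open>p\<close>-group the \<open>k\<close>-th power map is constant on the cosets of a central subgroup of
  order \<open>p\<close>.\<close>

lemma p_group_card_kth_powers:
  assumes p: "prime p" "p dvd k" and ord: "order G = p ^ i" "i > 0"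
  shows "2 * card (kth_powers G k) \<le> order G"
proof -
  obtain z where z: "z \<in> carrier G" "z \<noteq> \<one>" "z [^] p = \<one>" "cent G z = carrier G"
    using p_group_central_element [OF p(1) ord] .
  let ?F = "\<lambda>w. {v \<in> carrier G. v [^] k = w}"
  have zk: "z [^] k = \<one>" using pow_dvd_eq_one z p by blast
  have "2 \<le> card (?F w)" if w: "w \<in> kth_powers G k" for w
  proof -
    obtain v where v: "v \<in> carrier G" "v [^] k = w"
      using w by (auto simp: kth_powers_def)
    have "v \<otimes> z = z \<otimes> v" using z(4) v by (auto simp: cent_def)
    then have "(v \<otimes> z) [^] k = w"
      using v z zk by (metis nat_pow_closed pow_mult_distrib r_one)
    then have "{v, v \<otimes> z} \<subseteq> ?F w" using v z by auto
    moreover have "card {v, v \<otimes> z} = 2"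
      using v z by (simp add: card_insert_if)
    ultimately show ?thesis
      using card_mono [of "?F w" "{v, v \<otimes> z}"] by simp
  qed
  then have "2 * card (kth_powers G k) \<le> (\<Sum>w\<in>kth_powers G k. card (?F w))"
    using sum_mono [of "kth_powers G k" "\<lambda>_. 2" "\<lambda>w. card (?F w)"] by (simp add: mult.commute)
  also have "\<dots> = card (\<Union>w\<in>kth_powers G k. ?F w)"
  proof (rule card_UN_disjoint [symmetric])
    show "finite (kth_powers G k)"
      by (rule finite_subset [of _ "carrier G"]) (auto simp: kth_powers_def)
  qed auto
  also have "\<dots> \<le> order G"
    unfolding order_def by (rule card_mono) auto
  finally show ?thesis .
qed

lemma iso_integer_mod_group_4:
  assumes ord: "order G = 4" and y: "y \<in> carrier G" "y [^] (2::nat) \<noteq> \<one>"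
  shows "G \<cong> integer_mod_group 4"
proof -
  have y4: "y [^] (4::nat) = \<one>" using pow_order_eq_1 [OF y(1)] ord by simp
  have "ord y dvd 2 ^ 2"
    using pow_eq_id [OF y(1), of 4] y4 by simp
  then obtain j where j: "j \<le> 2" "ord y = 2 ^ j"
    using divides_primepow_nat [OF two_is_prime_nat, of "ord y" 2] by blast
  have "\<not> ord y dvd 2 ^ 1"
    using pow_eq_id [OF y(1), of 2] y(2) by simp
  then have "\<not> j \<le> 1" using j(2) le_imp_power_dvd by metis
  then have "j = 2" using j(1) by simp
  then have ord_y: "ord y = 4" using j(2) by simp
  let ?f = "\<lambda>i::int. y [^] nat i"
  have inj: "inj_on ?f {0..<4}"
  proof (rule inj_onI)
    fix i j :: int assume ij: "i \<in> {0..<4}" "j \<in> {0..<4}" "?f i = ?f j"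
    have "nat i \<in> {0..ord y - 1}" "nat j \<in> {0..ord y - 1}"
      using ij ord_y by auto
    then have "nat i = nat j"
      using ord_inj [OF y(1)] ij(3) by (auto dest: inj_onD)
    then show "i = j" using ij by auto
  qed
  have "?f \<in> iso (integer_mod_group 4) G"
    unfolding iso_def
  proof (intro CollectI conjI)
    show "?f \<in> hom (integer_mod_group 4) G"
    proof (rule homI)
      fix i j :: int assume "i \<in> carrier (integer_mod_group 4)" "j \<in> carrier (integer_mod_group 4)"
      then have ij: "0 \<le> i" "0 \<le> j" by (auto simp: carrier_integer_mod_group)
      have "y [^] nat ((i + j) mod 4) = y [^] (nat i + nat j)"
        by (rule pow_cong [OF y(1) y4]) (use ij in \<open>simp add: cong_def nat_mod_distrib nat_add_distrib\<close>)
      then show "?f (i \<otimes>\<^bsub>integer_mod_group 4\<^esub> j) = ?f i \<otimes> ?f j"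
        using y by (simp add: nat_pow_mult)
    qed (use y in simp)
    have "?f ` {0..<4} = carrier G"
    proof (rule card_subset_eq)
      show "card (?f ` {0..<4}) = card (carrier G)"
        using card_image [OF inj] ord by (simp add: order_def)
    qed (use y in auto)
    then show "bij_betw ?f (carrier (integer_mod_group 4)) (carrier G)"
      using inj by (simp add: bij_betw_def carrier_integer_mod_group)
  qed
  then have "integer_mod_group 4 \<cong> G" by (auto simp: is_iso_def)
  then show ?thesis by (rule group.iso_sym [OF group_integer_mod_group])
qed

lemma exists_prime_dvd_k:
  assumes "num_non_kth_powers G k > 0"
  obtains p where "prime p" "p dvd k" "p dvd order G"
proof -
  have "\<not> coprime k (order G)"
  proof
    assume cop: "coprime k (order G)"
    have "carrier G \<subseteq> kth_powers G k"
    proof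
      fix y assume y: "y \<in> carrier G"
      obtain v where "v \<in> carrier G" "v [^] k = y"
        using coprime_pow_root [OF y pow_order_eq_1 [OF y] cop] .
      then show "y \<in> kth_powers G k" by (auto simp: kth_powers_def)
    qed
    then show False
      using assms by (simp add: num_non_kth_powers_def non_kth_powers_def card_gt_0_iff)
  qed
  then have "gcd k (order G) \<noteq> 1" by (simp add: coprime_iff_gcd_eq_1)
  then obtain p where "prime p" "p dvd gcd k (order G)" using prime_factor_nat by blast
  then show thesis using that by auto
qed

end

context order_square
begin

lemma order_square_conclusion:
  "[k = 2] (mod 4) \<and> G \<cong> integer_mod_group 4"
proof -
  let ?K = "kth_powers G k"
  have p_dvd_order: "p dvd order G"
  proof (cases s)
    case 0
    then have "y [^] (p ^ b * r) = \<one>" if "y \<in> carrier G" for y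
      using pow_dvd_eq_one [OF that pow_order_eq_1 [OF that]] order_ps by simp
    then show ?thesis using pow_ex by blast
  qed (use order_ps in simp)
  obtain i where i: "order G = p ^ i" using p_group by blast
  have "i > 0"
    using i p_dvd_order prime_p by (cases i) auto
  have K_G: "?K \<subseteq> carrier G" by (auto simp: kth_powers_def)
  then have fK: "finite ?K" using finite_subset finite_carrier by blast
  have "card ?K \<le> order G"
    unfolding order_def by (rule card_mono [OF _ K_G]) simp
  moreover have "n = order G - card ?K"
    using card_Diff_subset [OF fK K_G]
    by (simp add: n_def num_non_kth_powers_def non_kth_powers_def order_def)
  ultimately have n_K: "n + card ?K = order G" by simp
  then have "order G \<le> 2 * n"
    using p_group_card_kth_powers [OF prime_p p_dvd_k i \<open>i > 0\<close>] by linarith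
  then have "n \<le> 2" using n_pos order_n by (simp add: power2_eq_square)
  moreover have "n \<noteq> 1"
    using order_n prime_p p_dvd_order by auto
  ultimately have n2: "n = 2" using n_pos by simp
  then have ord: "order G = 4" and K2: "card ?K = 2"
    using order_n n_K by simp_all
  have "p dvd 2 ^ 2" using p_dvd_order ord by simp
  then have "p = 2"
    using prime_p prime_dvd_power primes_dvd_imp_eq two_is_prime_nat by blast
  have "\<not> ?K \<subseteq> {\<one>}"
    using K2 card_mono [of "{\<one>}" ?K] by auto
  then obtain y where y: "y \<in> carrier G" "y [^] k \<noteq> \<one>"
    by (auto simp: kth_powers_def)
  have y4: "y [^] (4::nat) = \<one>" using pow_order_eq_1 [OF y(1)] ord by simp
  have "\<not> 4 dvd k"
    using pow_dvd_eq_one [OF y(1) y4] y(2) by blast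
  then have "k mod 4 = 2"
    using p_dvd_k \<open>p = 2\<close> by presburger
  moreover have "y [^] (2::nat) \<noteq> \<one>"
    using pow_dvd_eq_one [OF y(1)] y(2) p_dvd_k \<open>p = 2\<close> by blast
  ultimately show ?thesis
    using iso_integer_mod_group_4 [OF ord y(1)] by (simp add: cong_def)
qed

end

theorem theorem2:
  fixes G :: "('a, 'b) monoid_scheme" and k :: nat
  assumes "group G"
    and "finite (carrier G)"
    and "k > 0"
    and "order G = (num_non_kth_powers G k)\<^sup>2"
  shows "[k = 2] (mod 4) \<and> G \<cong> integer_mod_group 4"
proof -
  interpret finite_group G
    by (simp add: finite_group_def finite_group_axioms_def assms)
  have "num_non_kth_powers G k > 0"
    using assms(4) order_pos by (metis gr0I power_zero_numeral less_irrefl)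
  then obtain p where "prime p" "p dvd k" "p dvd order G"
    using exists_prime_dvd_k by blast
  then obtain s r b where "order_square G k (num_non_kth_powers G k) p s r b"
    using order_square_exists assms(4) by blast
  then show ?thesis
    by (rule order_square.order_square_conclusion)
qed

end
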